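(* Let $n\geq1$. (a) Let $\beta\in\mathcal{E}_q(n)$ with $N(\beta)=k$. (i) If $\alpha=(\beta,0)$ then for $Y\in B_q(n+1)$: $v_\alpha(Y)=q^kv_\beta(Y)$ if $Y\in B_q(n)$, and $v_\alpha(Y)=v_\beta(Y^r)$ if $Y\in A_q(n+1)$; moreover $\langle v_\alpha,v_\alpha\rangle_{n+1}=\frac{q^n+q^{2k}}{1+q^n}\langle v_\beta,v_\beta\rangle_n$. (ii) If $\alpha=(\beta,1)$ then for $Y\in B_q(n+1)$: $v_\alpha(Y)=q^{n-k}v_\beta(Y)$ if $Y\in B_q(n)$, and $v_\alpha(Y)=-v_\beta(Y^r)$ if $Y\in A_q(n+1)$; moreover $\langle v_\alpha,v_\alpha\rangle_{n+1}=\frac{q^n+q^{2(n-k)}}{1+q^n}\langle v_\beta,v_\beta\rangle_n$. (b) Let $\beta\in\mathcal{E}_q(n-1)$, $\chi\in\mathcal{N}_q(n)$, $\alpha=(\beta,\chi)\in\mathcal{E}_q(n+1)$ and $X=X(\chi)$. Then for $Y\in B_q(n+1)$: $|v_\alpha(Y)|=0$ if $Y\in B_q(n)$; $|v_\alpha(Y)|=|v_\beta(\tau(X)^{-1}(Y^r))|$ if $Y\in A_q(n+1)$ and $Y^r\subseteq X$; $|v_\alpha(Y)|=0$ if $Y\in A_q(n+1)$ and $Y^r\not\subseteq X$. Moreover $\langle v_\alpha,v_\alpha\rangle_{n+1}=\frac{q^n}{(1+q^{n-1})(1+q^n)}\langle v_\beta,v_\beta\rangle_{n-1}$. (c) For $Y\in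 B_q(n)$ and $\alpha\in\mathcal{E}_q(n)$: $|v_\alpha(Y)|=|v_{\overline\alpha}(Y)|$ and $\langle v_\alpha,v_\alpha\rangle_{n+1}=\langle v_{\overline\alpha},v_{\overline\alpha}\rangle_{n+1}$.
   Context: $q$ is a prime power. For $m\geq 0$, $\mathbb{F}_q^m$ is the space of column vectors of length $m$ over $\mathbb{F}_q$ with standard basis $e_1,\dots,e_m$; for $k<m$, $\mathbb{F}_q^k$ is identified with the subspace of vectors whose last $m-k$ coordinates vanish. $B_q(m)$ is the set of subspaces of $\mathbb{F}_q^m$; $B_q(X)$ is the set of subspaces of a space $X$. $\mathbb{C}[S]$ is the complex vector space with basis $S$; for $v=\sum_Yv(Y)Y$ the $v(Y)$ are its coordinates; $\mathbb{C}[B_q(m)]\subseteq\mathbb{C}[B_q(m+1)]$. For $m\geq0$ and $u,v\in\mathbb{C}[B_q(m)]$, $\langle u,v\rangle_m=\sum_{X\in B_q(m)}\overline{u(X)}v(X)q^{\binom{\dim X}{2}}/P_q(m)$ with $P_q(m)=\prod_{i=0}^{m-1}(1+q^i)$. Construction. Let $n\geq0$. $A_q(n+1)=\{Y\in B_q(n+1):Y\not\subseteq\mathbb{F}_q^n\}$ and for $Y\in A_q(n+1)$, $Y^r=Y\cap\mathbb{F}_q^n$. $\theta_n:\mathbb{C}[B_q(n)]\to\mathbb{C}[B_q(n+1)]$ is linear with $\theta_n(Z)=\sum Y$ over all $Y\in A_q(n+1)$ with $Y\cap\mathbb{F}_q^n=Z$. For $Z\in B_q(n)$, $\widehat Z$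 is the span of $Z$ and $e_{n+1}$. $H(n+1,\mathbb{F}_q)$ is the group of matrices $\begin{pmatrix}I_n&a\\0&1\end{pmatrix}$, $a\in\mathbb{F}_q^n$, acting on $A_q(n+1)$ by $Y\mapsto gY$ and linearly on $\mathbb{C}[A_q(n+1)]$. $\mathcal{N}_q(n)$ is the set of nontrivial homomorphisms $\chi:H(n+1,\mathbb{F}_q)\to\mathbb{C}^*$, and $p(\chi)(v)=\sum_g\overline{\chi(g)}\,gv$. It is a fact that for $n\geq1$, $\chi\in\mathcal{N}_q(n)$ there is a unique $(n-1)$-dimensional $X(\chi)\subseteq\mathbb{F}_q^n$ with $p(\chi)(\widehat{X(\chi)})\neq0$; $\lambda(\chi):\mathbb{C}[B_q(X(\chi))]\to\mathbb{C}[B_q(n+1)]$ is linear with $Y\mapsto q^{-\dim Y}p(\chi)(\widehat Y)$. For an $(n-1)$-dimensional $X\subseteq\mathbb{F}_q^n$, $M(X)$ is the unique $n\times(n-1)$ matrix in Schubert normal form (every column nonzero; last nonzero entry of column $j$ is $1$, in row $r_j$; $r_1<\dots<r_{n-1}$; rows $r_1,\dots,r_{n-1}$ form the identity) with column space $X$; $\tau(X):\mathbb{F}_q^{n-1}\to X$ is the linear isomorphism sending $e_j$ to column $j$ of $M(X)$ (it maps subspaces of $\mathbb{F}_q^{n-1}$ bijectively to subspaces of $X$); $\mu(X):\mathbb{C}[B_q(n-1)]\to\mathbb{C}[B_q(X)]$ is $Y\mapsto\tau(X)(Y)$. Index sets: $\mathcal{E}_q(0)=\{()\}$, $\mathcal{E}_q(1)=\{(0),(1)\}$,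 and for $n\geq2$, $\mathcal{E}_q(n)$ consists of the sequences $(\beta,0),(\beta,1)$ with $\beta\in\mathcal{E}_q(n-1)$ together with the sequences $(\beta,\chi)$ with $\beta\in\mathcal{E}_q(n-2)$, $\chi\in\mathcal{N}_q(n-1)$ ($(\beta,a)$ is $\beta$ with $a$ appended). $N(\alpha)$ is the number of entries of $\alpha$ not equal to $0$. For $\alpha\in\mathcal{E}_q(n)$, $\overline\alpha\in\mathcal{E}_q(n)$ is obtained by interchanging the entries $0$ and $1$ of $\alpha$ (other entries unchanged). Vectors: $v_{()}=\{0\}$, $v_{(0)}=\{0\}+\mathbb{F}_q$, $v_{(1)}=\{0\}-\mathbb{F}_q$. For $n\geq1$ and $\alpha=(\beta,a)\in\mathcal{E}_q(n+1)$ with $k=N(\beta)$: if $a=0$, $v_\alpha=q^kv_\beta+\theta_n(v_\beta)$; if $a=1$, $v_\alpha=q^{n-k}v_\beta-\theta_n(v_\beta)$; if $a=\chi\in\mathcal{N}_q(n)$ (so $\beta\in\mathcal{E}_q(n-1)$), $v_\alpha=\lambda(\chi)\big(\mu(X(\chi))(v_\beta)\big)$. *)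

theory Defs
  imports
    Complex_Main
    "HOL-Library.Function_Algebras"
    "HOL-Library.FuncSet"
    "HOL-Library.Cardinality"
    "HOL-Algebra.Group"
    "Jordan_Normal_Form.Matrix"
begin

text \<open>
  The finite field is a type \<open>'a :: {field, finite}\<close> with \<open>q = CARD('a)\<close>.

  Column vectors of length \<open>m\<close> are functions \<open>nat \<Rightarrow> 'a\<close> that vanish at all indices
  \<open>\<ge> m\<close> (coordinates are numbered from 0, so \<open>e\<^sub>i\<close> of the mathematical text is
  \<open>unit_fun (i - 1)\<close>). With this encoding the identification of \<open>F\<^sub>q\<^sup>k\<close> with the vectors of
  \<open>F\<^sub>q\<^sup>m\<close> whose last \<open>m - k\<close> coordinates vanish is a literal inclusion of sets.
\<close>

definition fscale :: "'b::field \<Rightarrow> ('i \<Rightarrow> 'b) \<Rightarrow> 'i \<Rightarrow> 'b"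
  where "fscale c f = (\<lambda>i. c * f i)"

global_interpretation fv: vector_space "fscale :: 'b::field \<Rightarrow> ('i \<Rightarrow> 'b) \<Rightarrow> 'i \<Rightarrow> 'b"
  by unfold_locales (auto simp: fscale_def fun_eq_iff algebra_simps)

definition Fq :: "nat \<Rightarrow> (nat \<Rightarrow> 'a::zero) set"
  where "Fq m = {x. \<forall>i\<ge>m. x i = 0}"

definition unit_fun :: "nat \<Rightarrow> nat \<Rightarrow> 'a::zero_neq_one"
  where "unit_fun j = (\<lambda>i. if i = j then 1 else 0)"

definition subspaces_of :: "(nat \<Rightarrow> 'a::field) set \<Rightarrow> (nat \<Rightarrow> 'a) set set"
  where "subspaces_of X = {Y. fv.subspace Y \<and> Y \<subseteq> X}"

abbreviation Bq :: "nat \<Rightarrow> (nat \<Rightarrow> 'a::field) set set"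
  where "Bq m \<equiv> subspaces_of (Fq m)"

text \<open>\<open>Aq m\<close> is only used for \<open>m \<ge> 1\<close>.\<close>

definition Aq :: "nat \<Rightarrow> (nat \<Rightarrow> 'a::field) set set"
  where "Aq m = {Y \<in> Bq m. \<not> Y \<subseteq> Fq (m - 1)}"

text \<open>
  The matrix \<open>A\<close> (with finitely many columns) acts on vectors encoded as functions;
  the result is again padded with zeros.
\<close>

definition pad_vec :: "'a::zero vec \<Rightarrow> nat \<Rightarrow> 'a"
  where "pad_vec w = (\<lambda>i. if i < dim_vec w then w $ i else 0)"

definition mat_act :: "'a::semiring_0 mat \<Rightarrow> (nat \<Rightarrow> 'a) \<Rightarrow> nat \<Rightarrow> 'a"
  where "mat_act A x = pad_vec (A *\<^sub>v vec (dim_col A) x)"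


subsection \<open>Free complex vector spaces on sets of subspaces\<close>

text \<open>
  An element of \<open>\<complex>[S]\<close>, for a finite set \<open>S\<close> of subspaces, is a function from all
  sets of vectors to \<open>complex\<close> that vanishes off \<open>S\<close>; its value at \<open>Y\<close> is the coordinate
  at \<open>Y\<close>. Thus \<open>\<complex>[B\<^sub>q(m)] \<subseteq> \<complex>[B\<^sub>q(m+1)]\<close> holds literally.
  Addition is the pointwise addition of functions, scaling is \<open>fscale\<close>.
\<close>

type_synonym 'a cvec = "(nat \<Rightarrow> 'a) set \<Rightarrow> complex"

definition basis_vec :: "(nat \<Rightarrow> 'a) set \<Rightarrow> 'a cvec"
  where "basis_vec Y = (\<lambda>Z. if Z = Y then 1 else 0)"

text \<open>The linear map on \<open>\<complex>[S]\<close> with prescribed values \<open>f Z\<close> on the basis vectors \<open>Z \<in> S\<close>.\<close>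

definition lin_ext ::
  "(nat \<Rightarrow> 'a) set set \<Rightarrow> ((nat \<Rightarrow> 'a) set \<Rightarrow> 'a cvec) \<Rightarrow> 'a cvec \<Rightarrow> 'a cvec"
  where "lin_ext S f u = (\<Sum>Z\<in>S. fscale (u Z) (f Z))"

definition Pq :: "nat \<Rightarrow> nat \<Rightarrow> nat"
  where "Pq q m = (\<Prod>i<m. 1 + q ^ i)"

definition cinner :: "nat \<Rightarrow> 'a::{field,finite} cvec \<Rightarrow> 'a cvec \<Rightarrow> complex"
  where "cinner m u v =
    (\<Sum>X\<in>Bq m. cnj (u X) * v X * of_nat (CARD('a) ^ (fv.dim X choose 2)) / of_nat (Pq CARD('a) m))"


subsection \<open>The linear maps of the construction\<close>

definition theta :: "nat \<Rightarrow> 'a::{field,finite} cvec \<Rightarrow> 'a cvec"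
  where "theta n = lin_ext (Bq n) (\<lambda>Z. \<Sum>Y \<in> {Y \<in> Aq (Suc n). Y \<inter> Fq n = Z}. basis_vec Y)"

definition hat :: "nat \<Rightarrow> (nat \<Rightarrow> 'a::field) set \<Rightarrow> (nat \<Rightarrow> 'a) set"
  where "hat n Z = fv.span (insert (unit_fun n) Z)"

text \<open>The group \<open>H(m, F\<^sub>q)\<close> for \<open>m \<ge> 1\<close>; the block \<open>A\<close> is a column of length \<open>m - 1\<close>.\<close>

definition Hq :: "nat \<Rightarrow> 'a::field mat monoid"
  where "Hq m = \<lparr>
     carrier = {four_block_mat (1\<^sub>m (m - 1)) A (0\<^sub>m 1 (m - 1)) (1\<^sub>m 1) | A. A \<in> carrier_mat (m - 1) 1},
     mult = (*),
     one = 1\<^sub>m m \<rparr>"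

definition Cstar :: "complex monoid"
  where "Cstar = \<lparr>carrier = UNIV - {0}, mult = (*), one = 1\<rparr>"

text \<open>
  Characters are \<open>extensional\<close>, so that two elements of \<open>Nq n\<close> are equal as soon as they agree
  on the group.
\<close>

definition Nq :: "nat \<Rightarrow> ('a::field mat \<Rightarrow> complex) set"
  where "Nq n = {\<chi> \<in> hom (Hq (Suc n)) Cstar \<inter> extensional (carrier (Hq (Suc n))).
                   \<exists>g \<in> carrier (Hq (Suc n)). \<chi> g \<noteq> 1}"

definition group_act :: "nat \<Rightarrow> 'a::field mat \<Rightarrow> 'a cvec \<Rightarrow> 'a cvec"
  where "group_act n g = lin_ext (Aq (Suc n)) (\<lambda>Y. basis_vec (mat_act g ` Y))"

definition pchi :: "nat \<Rightarrow> ('a::field mat \<Rightarrow> complex) \<Rightarrow> 'a cvec \<Rightarrow> 'a cvec"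
  where "pchi n \<chi> u = (\<Sum>g \<in> carrier (Hq (Suc n)). fscale (cnj (\<chi> g)) (group_act n g u))"

definition Xchi :: "nat \<Rightarrow> ('a::field mat \<Rightarrow> complex) \<Rightarrow> (nat \<Rightarrow> 'a) set"
  where "Xchi n \<chi> =
    (THE X. X \<in> Bq n \<and> fv.dim X = n - 1 \<and> pchi n \<chi> (basis_vec (hat n X)) \<noteq> 0)"

definition lambda :: "nat \<Rightarrow> ('a::{field,finite} mat \<Rightarrow> complex) \<Rightarrow> 'a cvec \<Rightarrow> 'a cvec"
  where "lambda n \<chi> = lin_ext (subspaces_of (Xchi n \<chi>))
     (\<lambda>Y. fscale (1 / of_nat (CARD('a) ^ fv.dim Y)) (pchi n \<chi> (basis_vec (hat n Y))))"

text \<open>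
  Schubert normal form of an \<open>n \<times> k\<close> matrix; \<open>r j\<close> is the row of the last nonzero entry of
  column \<open>j\<close>.
\<close>

definition schubert_form :: "nat \<Rightarrow> nat \<Rightarrow> 'a::field mat \<Rightarrow> bool"
  where "schubert_form n k M \<longleftrightarrow> M \<in> carrier_mat n k \<and>
    (\<exists>r. strict_mono_on {..<k} r \<and>
      (\<forall>j<k. r j < n \<and> M $$ (r j, j) = 1 \<and> (\<forall>i. r j < i \<and> i < n \<longrightarrow> M $$ (i, j) = 0)) \<and>
      (\<forall>i<k. \<forall>j<k. M $$ (r i, j) = (if i = j then 1 else 0)))"

definition column_space :: "'a::field mat \<Rightarrow> (nat \<Rightarrow> 'a) set"
  where "column_space M = fv.span {pad_vec (col M j) | j. j < dim_col M}"

definition schubert_mat :: "nat \<Rightarrow> (nat \<Rightarrow> 'a::field) set \<Rightarrow> 'a mat"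
  where "schubert_mat n X = (THE M. schubert_form n (n - 1) M \<and> column_space M = X)"

definition tau :: "nat \<Rightarrow> (nat \<Rightarrow> 'a::field) set \<Rightarrow> (nat \<Rightarrow> 'a) \<Rightarrow> nat \<Rightarrow> 'a"
  where "tau n X = mat_act (schubert_mat n X)"

definition mu :: "nat \<Rightarrow> (nat \<Rightarrow> 'a::field) set \<Rightarrow> 'a cvec \<Rightarrow> 'a cvec"
  where "mu n X = lin_ext (Bq (n - 1)) (\<lambda>Y. basis_vec (tau n X ` Y))"


subsection \<open>Index sequences and the vectors indexed by them\<close>

datatype 'a entry = EZero | EOne | EChar "'a mat \<Rightarrow> complex"

fun Eq :: "nat \<Rightarrow> 'a::field entry list set"
  where
    "Eq 0 = {[]}"
  | "Eq (Suc 0) = {[EZero], [EOne]}"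
  | "Eq (Suc (Suc n)) =
       {\<beta> @ [a] | \<beta> a. \<beta> \<in> Eq (Suc n) \<and> a \<in> {EZero, EOne}} \<union>
       {\<beta> @ [EChar \<chi>] | \<beta> \<chi>. \<beta> \<in> Eq n \<and> \<chi> \<in> Nq (Suc n)}"

definition nonzeros :: "'a entry list \<Rightarrow> nat"
  where "nonzeros \<alpha> = length (filter (\<lambda>a. a \<noteq> EZero) \<alpha>)"

fun swap_entry :: "'a entry \<Rightarrow> 'a entry"
  where
    "swap_entry EZero = EOne"
  | "swap_entry EOne = EZero"
  | "swap_entry (EChar \<chi>) = EChar \<chi>"

definition bar :: "'a entry list \<Rightarrow> 'a entry list"
  where "bar = map swap_entry"

text \<open>
  \<open>vvec n \<alpha>\<close> is the vector \<open>v\<^sub>\<alpha>\<close> for \<open>\<alpha> \<in> Eq n\<close> (for other \<open>\<alpha>\<close> the value is irrelevant).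
  The exponent \<open>Suc n - k\<close> is not truncated, see \<open>nonzeros_le\<close> below.
\<close>

fun vvec :: "nat \<Rightarrow> 'a::{field,finite} entry list \<Rightarrow> 'a cvec"
  where
    "vvec 0 \<alpha> = basis_vec {0}"
  | "vvec (Suc 0) \<alpha> =
       (if \<alpha> = [EZero] then basis_vec {0} + basis_vec (Fq 1) else basis_vec {0} - basis_vec (Fq 1))"
  | "vvec (Suc (Suc n)) \<alpha> =
       (let \<beta> = butlast \<alpha>; k = nonzeros \<beta>; q = of_nat CARD('a) in
        case last \<alpha> of
          EZero \<Rightarrow> fscale (q ^ k) (vvec (Suc n) \<beta>) + theta (Suc n) (vvec (Suc n) \<beta>)
        | EOne \<Rightarrow> fscale (q ^ (Suc n - k)) (vvec (Suc n) \<beta>) - theta (Suc n) (vvec (Suc n) \<beta>)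
        | EChar \<chi> \<Rightarrow> lambda (Suc n) \<chi> (mu (Suc n) (Xchi (Suc n) \<chi>) (vvec n \<beta>)))"

lemma nonzeros_le: "\<alpha> \<in> Eq n \<Longrightarrow> nonzeros \<alpha> \<le> n"
  by (induction n arbitrary: \<alpha> rule: Eq.induct) (fastforce simp: nonzeros_def)+

lemma bar_in_Eq: "\<alpha> \<in> Eq n \<Longrightarrow> bar \<alpha> \<in> Eq n"
  by (induction n arbitrary: \<alpha> rule: Eq.induct) (auto simp: bar_def)

end

theory Submission
  imports Defs
begin

text \<open>
  A subspace \<open>Y\<close> in \<open>A\<^sub>q(n+1)\<close> is determined by its section \<open>Z = Y \<inter> F\<^sub>q\<^sup>n\<close> together with the
  coset \<open>w + Z\<close> of the vectors \<open>w\<close> with \<open>e\<^sub>n\<^sub>+\<^sub>1 + w \<in> Y\<close>; hence \<open>Z\<close> is the section of exactly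
  \<open>q\<^sup>n\<^sup>-\<^sup>d\<close> such \<open>Y\<close>, where \<open>d = dim Z\<close>. The dimension goes up by one, so the weight grows by the
  factor \<open>q\<^sup>d\<close>, which compensates the number of lifts: the norm formulas follow.

  A character \<open>\<chi>\<close> of \<open>H(n+1, F\<^sub>q)\<close> is an additive character of \<open>F\<^sub>q\<^sup>n\<close>, and the coordinate of
  \<open>p(\<chi>)\<close> applied to the hat of \<open>Z\<close> at such a \<open>Y\<close> is the sum of the conjugate of \<open>\<chi>\<close> over
  \<open>w + Z\<close>. It has modulus \<open>q\<^sup>d\<close> if \<open>\<chi>\<close> is trivial on \<open>Z\<close> and vanishes otherwise. Therefore
  \<open>X(\<chi>)\<close> is the hyperplane on which \<open>\<chi>\<close> is trivial. It exists because the sum of \<open>\<chi>\<close> over a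
  hyperplane does not vanish on average, and it is unique because two distinct hyperplanes
  span the whole space.
\<close>

section \<open>Subspaces over a finite field\<close>

lemma fv_subspace_Fq: "fv.subspace (Fq n :: (nat \<Rightarrow> 'a::field) set)"
  by (auto simp: fv.subspace_def Fq_def fscale_def)

text \<open>Forgetting the padding zeros gives the extensional functions on \<open>n\<close>
  indices, so finiteness and size of \<open>Fq n\<close> come from \<open>PiE\<close>.\<close>

lemma Fq_bij_PiE:
  "bij_betw (\<lambda>x. restrict x {..<n}) (Fq n :: (nat \<Rightarrow> 'a::field) set) ({..<n} \<rightarrow>\<^sub>E UNIV)"
  by (rule bij_betw_byWitness[where f' = "\<lambda>f i. if i < n then f i else 0"])
    (auto simp: Fq_def PiE_def extensional_def fun_eq_iff)

lemma finite_Fq [simp]: "finite (Fq n :: (nat \<Rightarrow> 'a::{field,finite}) set)"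
  using bij_betw_finite[OF Fq_bij_PiE, of n] by (auto intro: finite_PiE)

lemma card_Fq: "card (Fq n :: (nat \<Rightarrow> 'a::{field,finite}) set) = CARD('a) ^ n"
  using bij_betw_same_card[OF Fq_bij_PiE, of n] by (simp add: card_PiE)

lemma Fq_mono: "m \<le> n \<Longrightarrow> Fq m \<subseteq> Fq n"
  by (auto simp: Fq_def)

lemma finite_subspaces_of: "finite X \<Longrightarrow> finite (subspaces_of X)"
  by (rule finite_subset[of _ "Pow X"]) (auto simp: subspaces_of_def)

lemma subspaces_of_mono: "X \<subseteq> Y \<Longrightarrow> subspaces_of X \<subseteq> subspaces_of Y"
  by (auto simp: subspaces_of_def)

lemma finite_Bq [simp]: "finite (Bq n :: (nat \<Rightarrow> 'a::{field,finite}) set set)"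
  by (simp add: finite_subspaces_of)

lemma BqD: "Y \<in> Bq n \<Longrightarrow> fv.subspace Y" "Y \<in> Bq n \<Longrightarrow> Y \<subseteq> Fq n"
  by (auto simp: subspaces_of_def)

lemma finite_in_Bq: "(Y :: (nat \<Rightarrow> 'a::{field,finite}) set) \<in> Bq n \<Longrightarrow> finite Y"
  using BqD(2) finite_Fq finite_subset by blast

text \<open>Coordinates with respect to a basis identify \<open>Y\<close> with the functions from
  that basis to the field. Together with its converse \<open>dim_eqI\<close> this reduces the
  dimensions below to counts.\<close>

lemma card_subspace:
  fixes Y :: "('i \<Rightarrow> 'a::{field,finite}) set"
  assumes Y: "fv.subspace Y" "finite Y"
  shows "card Y = CARD('a) ^ fv.dim Y"
proof -
  obtain B where B: "B \<subseteq> Y" "fv.independent B" "Y \<subseteq> fv.span B" "card B = fv.dim Y"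
    using fv.basis_exists by blast
  have fB: "finite B"
    using B(1) Y(2) finite_subset by blast
  have sp: "fv.span B = Y"
    using B(1,3) Y(1) fv.span_minimal by blast
  let ?g = "\<lambda>f. \<Sum>b\<in>B. fscale (f b) b"
  have "inj_on ?g (B \<rightarrow>\<^sub>E UNIV)"
  proof (rule inj_onI)
    fix f h assume f: "f \<in> B \<rightarrow>\<^sub>E (UNIV :: 'a set)" and h: "h \<in> B \<rightarrow>\<^sub>E (UNIV :: 'a set)"
      and eq: "?g f = ?g h"
    have "(\<Sum>b\<in>B. fscale (f b - h b) b) = 0"
      using eq by (simp add: fv.scale_left_diff_distrib sum_subtractf)
    then have "f b - h b = 0" if "b \<in> B" for b
      using fv.independentD[OF B(2) fB subset_refl, of "\<lambda>b. f b - h b"] that by blast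
    then show "f = h"
      using f h by (intro PiE_ext[of f B _ h]) auto
  qed
  moreover have "?g ` (B \<rightarrow>\<^sub>E UNIV) = Y"
  proof
    show "?g ` (B \<rightarrow>\<^sub>E UNIV) \<subseteq> Y"
      using B(1) Y(1) by (auto intro!: fv.subspace_sum fv.subspace_scale)
    show "Y \<subseteq> ?g ` (B \<rightarrow>\<^sub>E UNIV)"
    proof
      fix y assume "y \<in> Y"
      then obtain u where u: "y = ?g u"
        using fv.span_finite[OF fB] sp by auto
      show "y \<in> ?g ` (B \<rightarrow>\<^sub>E UNIV)"
        by (rule image_eqI[of _ _ "restrict u B"]) (auto simp: u intro: sum.cong)
    qed
  qed
  ultimately have "card Y = card (B \<rightarrow>\<^sub>E (UNIV :: 'a set))"
    using card_image[of ?g "B \<rightarrow>\<^sub>E UNIV"] by simp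
  then show ?thesis
    using fB B(4) by (simp add: card_PiE)
qed

lemma CARD_field_gt_1: "CARD('a::{field,finite}) > 1"
proof -
  have "card {0, 1 :: 'a} \<le> CARD('a)" by (intro card_mono) auto
  then show ?thesis by simp
qed

lemma dim_eqI:
  fixes Y :: "('i \<Rightarrow> 'a::{field,finite}) set"
  assumes "fv.subspace Y" "finite Y" "card Y = CARD('a) ^ d"
  shows "fv.dim Y = d"
  using card_subspace[OF assms(1,2)] assms(3) CARD_field_gt_1[where 'a='a]
  by simp

text \<open>\<open>V\<close> is the direct sum of the line through \<open>v\<close> and the kernel:
  the quotient of \<open>f x\<close> by \<open>f v\<close> is the component along \<open>v\<close>.
  Applied to the last coordinate and to the functionals defining hyperplanes.\<close>

lemma card_functional_kernel:
  fixes V :: "('i \<Rightarrow> 'a::{field,finite}) set" and f :: "('i \<Rightarrow> 'a) \<Rightarrow> 'a"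
  assumes V: "fv.subspace V"
    and add: "\<And>x y. f (x + y) = f x + f y" and scale: "\<And>c x. f (fscale c x) = c * f x"
    and v: "v \<in> V" "f v \<noteq> 0"
  shows "card V = CARD('a) * card {x \<in> V. f x = 0}"
proof -
  have diff: "f (x - y) = f x - f y" for x y
    using add[of "x - y" y] by (simp add: algebra_simps)
  have "bij_betw (\<lambda>p. fscale (fst p) v + snd p) (UNIV \<times> {x \<in> V. f x = 0}) V"
  proof (rule bij_betw_byWitness[where f' = "\<lambda>x. (f x / f v, x - fscale (f x / f v) v)"])
    show "\<forall>p\<in>UNIV \<times> {x \<in> V. f x = 0}. (f (fscale (fst p) v + snd p) / f v,
        fscale (fst p) v + snd p - fscale (f (fscale (fst p) v + snd p) / f v) v) = p"
      using v(2) by (clarsimp simp: add scale)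
    show "(\<lambda>p. fscale (fst p) v + snd p) ` (UNIV \<times> {x \<in> V. f x = 0}) \<subseteq> V"
      using V v by (auto intro!: fv.subspace_add fv.subspace_scale)
    show "(\<lambda>x. (f x / f v, x - fscale (f x / f v) v)) ` V \<subseteq> UNIV \<times> {x \<in> V. f x = 0}"
      using V v by (auto simp: diff scale intro!: fv.subspace_diff fv.subspace_scale)
  qed simp
  then show ?thesis
    by (simp add: bij_betw_same_card[symmetric] card_cartesian_product)
qed

section \<open>Lifting subspaces by one dimension\<close>

lemma AqD: "Y \<in> Aq (Suc n) \<Longrightarrow> Y \<in> Bq (Suc n)" "Y \<in> Aq (Suc n) \<Longrightarrow> \<not> Y \<subseteq> Fq n"
  by (auto simp: Aq_def)

lemma Bq_Suc: "Bq (Suc n) = Bq n \<union> Aq (Suc n)" "Bq n \<inter> Aq (Suc n) = {}"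
  using subspaces_of_mono[OF Fq_mono[of n "Suc n"]] by (auto simp: Aq_def subspaces_of_def)

lemma finite_Aq [simp]: "finite (Aq n :: (nat \<Rightarrow> 'a::{field,finite}) set set)"
  by (rule finite_subset[of _ "Bq n"]) (auto simp: Aq_def)

lemma Aq_section: "Y \<in> Aq (Suc n) \<Longrightarrow> Y \<inter> Fq n \<in> Bq n"
  by (auto simp: Aq_def subspaces_of_def intro: fv.subspace_inter fv_subspace_Fq)

lemma Fq_Suc_iff: "x \<in> Fq (Suc n) \<and> x n = 0 \<longleftrightarrow> x \<in> Fq n"
  unfolding Fq_def mem_Collect_eq by (metis Suc_leI Suc_leD le_neq_implies_less order_refl)

text \<open>The last coordinate is a functional on \<open>Y\<close> that is not identically zero and
  has the section as its kernel.\<close>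

lemma dim_Aq:
  fixes Y :: "(nat \<Rightarrow> 'a::{field,finite}) set"
  assumes Y: "Y \<in> Aq (Suc n)"
  shows "fv.dim Y = Suc (fv.dim (Y \<inter> Fq n))"
proof (rule dim_eqI)
  have sub: "Y \<subseteq> Fq (Suc n)" using AqD(1)[OF Y] BqD by blast
  obtain y where y: "y \<in> Y" "y n \<noteq> 0"
    using AqD(2)[OF Y] sub Fq_Suc_iff by blast
  have "{x \<in> Y. x n = 0} = Y \<inter> Fq n" using sub Fq_Suc_iff by blast
  moreover have "card (Y \<inter> Fq n) = CARD('a) ^ fv.dim (Y \<inter> Fq n)"
    using Aq_section[OF Y] by (intro card_subspace) (auto simp: subspaces_of_def)
  ultimately show "card Y = CARD('a) ^ Suc (fv.dim (Y \<inter> Fq n))"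
    using card_functional_kernel[of Y "\<lambda>x. x n", OF _ _ _ y] BqD(1)[OF AqD(1)[OF Y]]
    by (simp add: fscale_def)
qed (use AqD(1)[OF Y] BqD finite_in_Bq in auto)

text \<open>The span of \<open>Z\<close> and \<open>e\<^sub>n\<^sub>+\<^sub>1 + w\<close>, for \<open>Z\<close> and \<open>w\<close> inside \<open>Fq n\<close>.\<close>

definition lift_space :: "nat \<Rightarrow> (nat \<Rightarrow> 'a::field) set \<Rightarrow> (nat \<Rightarrow> 'a) \<Rightarrow> (nat \<Rightarrow> 'a) set"
  where "lift_space n Z w = {y. y - fscale (y n) (unit_fun n + w) \<in> Z}"

lemma unit_fun_in_Fq: "i < n \<Longrightarrow> unit_fun i \<in> Fq n"
  by (auto simp: unit_fun_def Fq_def)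

text \<open>Sending \<open>y\<close> to \<open>y - fscale (y n) (unit_fun n + w)\<close> is linear
  and kills coordinate \<open>n\<close>, so \<open>lift_space n Z w\<close> is the preimage of
  \<open>Z\<close> under a linear map. On \<open>Fq n\<close> this map is the identity, which gives
  the section.\<close>

lemma lift_space_in_Aq:
  assumes Z: "Z \<in> Bq n" and w: "w \<in> Fq n"
  shows "lift_space n Z w \<in> Aq (Suc n)" "lift_space n Z w \<inter> Fq n = Z" "unit_fun n + w \<in> lift_space n Z w"
proof -
  have wn: "(unit_fun n + w) n = 1" using w by (simp add: unit_fun_def Fq_def)
  then show u: "unit_fun n + w \<in> lift_space n Z w"
    using BqD(1)[OF Z] by (simp add: lift_space_def fv.subspace_0 del: plus_fun_apply)
  have unF: "unit_fun n + w \<notin> Fq n" using wn by (auto simp: Fq_def simp del: plus_fun_apply)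
  have F: "unit_fun n + w \<in> Fq (Suc n)"
    using w Fq_mono[of n "Suc n"] unit_fun_in_Fq[of n "Suc n"]
    by (auto intro!: fv.subspace_add fv_subspace_Fq)
  have "fv.subspace (lift_space n Z w)"
    unfolding fv.subspace_def
  proof (intro conjI ballI allI)
    show "0 \<in> lift_space n Z w" using BqD(1)[OF Z] by (simp add: lift_space_def fv.subspace_0)
  next
    fix x y assume "x \<in> lift_space n Z w" "y \<in> lift_space n Z w"
    then have "(x - fscale (x n) (unit_fun n + w)) + (y - fscale (y n) (unit_fun n + w)) \<in> Z"
      using BqD(1)[OF Z] by (auto simp: lift_space_def intro: fv.subspace_add)
    then show "x + y \<in> lift_space n Z w"
      by (simp add: lift_space_def algebra_simps)
  next
    fix c x assume "x \<in> lift_space n Z w"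
    then have "fscale c (x - fscale (x n) (unit_fun n + w)) \<in> Z"
      using BqD(1)[OF Z] by (auto simp: lift_space_def intro: fv.subspace_scale)
    moreover have "fscale c x n = c * x n" by (simp add: fscale_def)
    ultimately show "fscale c x \<in> lift_space n Z w"
      by (simp add: lift_space_def fv.scale_right_diff_distrib)
  qed
  moreover have "lift_space n Z w \<subseteq> Fq (Suc n)"
  proof
    fix y assume "y \<in> lift_space n Z w"
    then have "y - fscale (y n) (unit_fun n + w) \<in> Fq (Suc n)"
      using BqD(2)[OF Z] Fq_mono[of n "Suc n"] by (auto simp: lift_space_def)
    from fv.subspace_add[OF fv_subspace_Fq this fv.subspace_scale[OF fv_subspace_Fq F, of "y n"]]
    show "y \<in> Fq (Suc n)" by simp
  qed
  ultimately show "lift_space n Z w \<in> Aq (Suc n)"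
    using u unF by (auto simp: Aq_def subspaces_of_def)
  have "y \<in> lift_space n Z w \<longleftrightarrow> y \<in> Z" if "y \<in> Fq n" for y
    using that by (simp add: lift_space_def Fq_def)
  then show "lift_space n Z w \<inter> Fq n = Z" using BqD(2)[OF Z] by blast
qed

text \<open>Subtracting the multiple of \<open>unit_fun n + w\<close> with the same last coordinate
  moves a vector of \<open>Y\<close> into the section without leaving \<open>Y\<close>.\<close>

lemma Aq_eq_lift_space:
  assumes Y: "Y \<in> Aq (Suc n)" and w: "w \<in> Fq n" "unit_fun n + w \<in> Y"
  shows "Y = lift_space n (Y \<inter> Fq n) w"
proof -
  have sY: "fv.subspace Y" and YF: "Y \<subseteq> Fq (Suc n)" using AqD(1)[OF Y] BqD by blast+
  have uF: "unit_fun n + w \<in> Fq (Suc n)" using w YF by blast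
  have wn: "w n = 0" using w(1) by (simp add: Fq_def)
  show ?thesis
  proof (intro Set.set_eqI iffI)
    fix y assume y: "y \<in> Y"
    let ?d = "y - fscale (y n) (unit_fun n + w)"
    have "?d \<in> Y" using y w sY by (intro fv.subspace_diff fv.subspace_scale)
    moreover have "?d n = 0" using wn by (simp add: fscale_def unit_fun_def)
    ultimately show "y \<in> lift_space n (Y \<inter> Fq n) w"
      using YF Fq_Suc_iff[of ?d n] by (auto simp: lift_space_def)
  next
    fix y assume "y \<in> lift_space n (Y \<inter> Fq n) w"
    then have "y - fscale (y n) (unit_fun n + w) \<in> Y" by (simp add: lift_space_def)
    from fv.subspace_add[OF sY this fv.subspace_scale[OF sY w(2), of "y n"]]
    show "y \<in> Y" by simp
  qed
qed

lemma Aq_obtain_lift: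
  assumes Y: "Y \<in> Aq (Suc n)"
  obtains w where "w \<in> Fq n" "unit_fun n + w \<in> Y"
proof -
  have sY: "fv.subspace Y" and YF: "Y \<subseteq> Fq (Suc n)" using AqD(1)[OF Y] BqD by blast+
  obtain y where y: "y \<in> Y" "y n \<noteq> 0"
    using AqD(2)[OF Y] YF Fq_Suc_iff by blast
  \<comment> \<open>Rescaling makes the last coordinate of \<open>y\<close> equal to 1, so removing
    \<open>unit_fun n\<close> leaves a vector of \<open>Fq n\<close>.\<close>
  define w where "w = fscale (inverse (y n)) y - unit_fun n"
  have "fscale (inverse (y n)) y \<in> Y" using y sY by (intro fv.subspace_scale)
  then have 1: "unit_fun n + w \<in> Y" by (simp add: w_def)
  have "w \<in> Fq (Suc n)"
    using y YF unit_fun_in_Fq[of n "Suc n"]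
    by (auto simp: w_def intro!: fv.subspace_diff fv.subspace_scale fv_subspace_Fq)
  moreover have "w n = 0" using y by (simp add: w_def fscale_def unit_fun_def)
  ultimately show thesis using that 1 Fq_Suc_iff by blast
qed

text \<open>Two vectors of \<open>Y\<close> with last coordinate 1 differ by an element of the
  section. This coset description drives both the count of lifts and the character sums.\<close>

lemma lift_space_fibre:
  assumes Y: "Y \<in> Aq (Suc n)" and w: "w \<in> Fq n" "unit_fun n + w \<in> Y"
  shows "{a \<in> Fq n. lift_space n (Y \<inter> Fq n) a = Y} = (+) w ` (Y \<inter> Fq n)"
proof (intro Set.set_eqI iffI)
  have sY: "fv.subspace Y" using AqD(1)[OF Y] BqD by blast
  {
    fix a assume "a \<in> {a \<in> Fq n. lift_space n (Y \<inter> Fq n) a = Y}"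
    then have a: "a \<in> Fq n" "unit_fun n + a \<in> Y"
      using lift_space_in_Aq(3)[OF Aq_section[OF Y], of a] by auto
    then have "(unit_fun n + a) - (unit_fun n + w) \<in> Y" using sY w by (intro fv.subspace_diff)
    moreover have "a - w \<in> Fq n" using a w by (intro fv.subspace_diff fv_subspace_Fq)
    ultimately have "a - w \<in> Y \<inter> Fq n" by simp
    then have "w + (a - w) \<in> (+) w ` (Y \<inter> Fq n)" by (rule imageI)
    then show "a \<in> (+) w ` (Y \<inter> Fq n)" by simp
  next
    fix a assume "a \<in> (+) w ` (Y \<inter> Fq n)"
    then obtain z where z: "a = w + z" "z \<in> Y" "z \<in> Fq n" by blast
    have "unit_fun n + a \<in> Y" using fv.subspace_add[OF sY w(2) z(2)] z(1) by (simp add: add.assoc)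
    moreover have "a \<in> Fq n" using z w by (auto intro: fv.subspace_add fv_subspace_Fq)
    ultimately show "a \<in> {a \<in> Fq n. lift_space n (Y \<inter> Fq n) a = Y}"
      using Aq_eq_lift_space[OF Y, of a] by auto
  }
qed

text \<open>Taking \<open>a\<close> to \<open>lift_space n Z a\<close> maps \<open>Fq n\<close> onto
  these lifts, and each fibre is a coset of \<open>Z\<close>. The product form avoids the exponent
  \<open>n - fv.dim Z\<close>.\<close>

lemma card_Aq_fibre:
  fixes Z :: "(nat \<Rightarrow> 'a::{field,finite}) set"
  assumes Z: "Z \<in> Bq n"
  shows "card {Y \<in> Aq (Suc n). Y \<inter> Fq n = Z} * CARD('a) ^ fv.dim Z = CARD('a) ^ n"
proof -
  let ?S = "{Y \<in> Aq (Suc n). Y \<inter> Fq n = Z}"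
  have fS: "finite ?S" by simp
  have fibre: "card {a \<in> Fq n. lift_space n Z a = Y} = card Z" if Y: "Y \<in> ?S" for Y
  proof -
    obtain w where w: "w \<in> Fq n" "unit_fun n + w \<in> Y" using Y Aq_obtain_lift by blast
    have "{a \<in> Fq n. lift_space n Z a = Y} = (+) w ` Z" using lift_space_fibre[OF _ w] Y by auto
    then show ?thesis by (simp add: card_image)
  qed
  have "card (Fq n :: (nat \<Rightarrow> 'a) set) = (\<Sum>Y\<in>?S. card {a \<in> Fq n. lift_space n Z a = Y})"
    using lift_space_in_Aq[OF Z] by (subst card_eq_sum, subst sum.group[symmetric, of _ ?S "lift_space n Z"]) auto
  also have "\<dots> = card ?S * card Z" by (simp add: fibre)
  also have "card Z = CARD('a) ^ fv.dim Z"
    using Z by (intro card_subspace BqD finite_in_Bq)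
  finally show ?thesis by (simp add: card_Fq)
qed

text \<open>After grouping \<open>Y\<close> by section, the number of lifts times the gain in weight
  is \<open>q^n\<close>, whatever the dimension of the section.\<close>

lemma sum_Aq:
  fixes F :: "(nat \<Rightarrow> 'a::{field,finite}) set \<Rightarrow> complex"
  shows "(\<Sum>Y\<in>Aq (Suc n). F (Y \<inter> Fq n) * of_nat (CARD('a) ^ (fv.dim Y choose 2))) =
    of_nat CARD('a) ^ n * (\<Sum>Z\<in>Bq n. F Z * of_nat (CARD('a) ^ (fv.dim Z choose 2)))"
proof -
  let ?S = "\<lambda>Z. {Y \<in> Aq (Suc n). Y \<inter> Fq n = Z}"
  have "(\<Sum>Y\<in>Aq (Suc n). F (Y \<inter> Fq n) * of_nat (CARD('a) ^ (fv.dim Y choose 2))) =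
    (\<Sum>Z\<in>Bq n. \<Sum>Y\<in>?S Z. F (Y \<inter> Fq n) * of_nat (CARD('a) ^ (fv.dim Y choose 2)))"
    using Aq_section by (intro sum.group[symmetric]) auto
  also have "\<dots> = (\<Sum>Z\<in>Bq n. of_nat CARD('a) ^ n * (F Z * of_nat (CARD('a) ^ (fv.dim Z choose 2))))"
  proof (rule sum.cong[OF refl])
    fix Z :: "(nat \<Rightarrow> 'a) set" assume Z: "Z \<in> Bq n"
    have "Suc d choose 2 = d + (d choose 2)" for d by (simp add: numeral_2_eq_2)
    then have "(\<Sum>Y\<in>?S Z. F (Y \<inter> Fq n) * of_nat (CARD('a) ^ (fv.dim Y choose 2))) =
      (\<Sum>Y\<in>?S Z. F Z * of_nat (CARD('a) ^ (fv.dim Z + (fv.dim Z choose 2))))"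
      by (intro sum.cong) (auto simp: dim_Aq)
    also have "\<dots> = of_nat (card (?S Z) * CARD('a) ^ fv.dim Z) *
        (F Z * of_nat (CARD('a) ^ (fv.dim Z choose 2)))"
      by (simp add: power_add mult_ac)
    finally show "(\<Sum>Y\<in>?S Z. F (Y \<inter> Fq n) * of_nat (CARD('a) ^ (fv.dim Y choose 2))) =
      of_nat CARD('a) ^ n * (F Z * of_nat (CARD('a) ^ (fv.dim Z choose 2)))"
      by (simp add: card_Aq_fibre[OF Z])
  qed
  finally show ?thesis by (simp add: sum_distrib_left)
qed

section \<open>The group of translations\<close>

lemma sum_fun_apply: "(\<Sum>x\<in>A. f x) y = (\<Sum>x\<in>A. f x y)"
  by (induction A rule: infinite_finite_induct) auto

lemma lin_ext_apply: "lin_ext S f u Y = (\<Sum>Z\<in>S. u Z * f Z Y)"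
  by (simp add: lin_ext_def sum_fun_apply fscale_def)

lemma lin_ext_basis_vec: "finite S \<Longrightarrow> Z \<in> S \<Longrightarrow> lin_ext S f (basis_vec Z) = f Z"
  by (rule ext) (simp add: lin_ext_apply basis_vec_def if_distrib[where f = "\<lambda>x. x * _"] sum.delta
      cong: if_cong)

lemma mat_act_apply:
  "mat_act A x i = (if i < dim_row A then \<Sum>j<dim_col A. A $$ (i, j) * x j else 0)"
  by (auto simp: mat_act_def pad_vec_def scalar_prod_def atLeast0LessThan intro: sum.cong)

text \<open>Parametrises the group by padded vectors; the map is injective on \<open>Fq n\<close>,
  so sums over the group become sums over \<open>Fq n\<close>.\<close>

definition hmat :: "nat \<Rightarrow> (nat \<Rightarrow> 'a::field) \<Rightarrow> 'a mat"
  where "hmat n a =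
    four_block_mat (1\<^sub>m n) (mat n 1 (\<lambda>(i, j). a i)) (0\<^sub>m 1 n) (1\<^sub>m 1)"

lemma carrier_Hq: "carrier (Hq (Suc n)) = hmat n ` Fq n"
proof (intro Set.set_eqI iffI)
  fix g :: "'a mat" assume "g \<in> carrier (Hq (Suc n))"
  then obtain A where A: "A \<in> carrier_mat n 1"
    and g: "g = four_block_mat (1\<^sub>m n) A (0\<^sub>m 1 n) (1\<^sub>m 1)"
    by (auto simp: Hq_def)
  let ?a = "\<lambda>i. if i < n then A $$ (i, 0) else 0"
  have "mat n 1 (\<lambda>(i, j). ?a i) = A"
    using A by (intro eq_matI) auto
  then have "g = hmat n ?a" by (simp add: g hmat_def)
  moreover have "?a \<in> Fq n" by (simp add: Fq_def)
  ultimately show "g \<in> hmat n ` Fq n" by blast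
next
  fix g :: "'a mat" assume "g \<in> hmat n ` Fq n"
  then obtain a where "g = hmat n a" by blast
  then show "g \<in> carrier (Hq (Suc n))"
    unfolding Hq_def hmat_def by (auto intro!: exI[of _ "mat n 1 (\<lambda>(i, j). a i)"])
qed

lemma dim_hmat [simp]: "dim_row (hmat n a) = Suc n" "dim_col (hmat n a) = Suc n"
  by (simp_all add: hmat_def)

lemma hmat_index:
  "i < Suc n \<Longrightarrow> j < Suc n \<Longrightarrow> hmat n a $$ (i, j) =
    (if j = n then if i = n then 1 else a i else if i = j then 1 else 0)"
  by (auto simp: hmat_def less_Suc_eq)

lemma inj_on_hmat: "inj_on (hmat n) (Fq n)"
proof (rule inj_onI)
  fix a b :: "nat \<Rightarrow> 'a" assume ab: "a \<in> Fq n" "b \<in> Fq n" "hmat n a = hmat n b"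
  show "a = b"
  proof (rule ext)
    fix i show "a i = b i"
      using ab hmat_index[of i n n a] hmat_index[of i n n b]
      by (cases "i < n") (auto simp: Fq_def)
  qed
qed

lemma mat_act_hmat:
  assumes "x \<in> Fq (Suc n)" "a \<in> Fq n"
  shows "mat_act (hmat n a) x = x + fscale (x n) a"
proof (rule ext)
  fix i
  have "(\<Sum>j<n. (if i = j then 1 else 0) * x j) = x i" if "i < n"
    using that by (simp add: if_distrib[where f = "\<lambda>x. x * _"] sum.delta cong: if_cong)
  moreover have "(\<Sum>j<n. hmat n a $$ (i, j) * x j) = (\<Sum>j<n. (if i = j then 1 else 0) * x j)"
    if "i < Suc n" using that by (intro sum.cong) (auto simp: hmat_index)
  moreover have "(\<Sum>j<n. (if n = j then 1 else 0) * x j) = 0"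
    by (intro sum.neutral) auto
  moreover have "a n = 0" "i \<ge> Suc n \<Longrightarrow> a i = 0" "i \<ge> Suc n \<Longrightarrow> x i = 0"
    using assms by (auto simp: Fq_def)
  ultimately show "mat_act (hmat n a) x i = (x + fscale (x n) a) i"
    by (cases "i = n"; cases "i < n") (auto simp: mat_act_apply hmat_index fscale_def)
qed

text \<open>Every column of \<open>hmat n a\<close> but the last is a column of the identity. As
  products become sums, characters of the group become additive characters of
  \<open>Fq n\<close>.\<close>

lemma hmat_mult: "hmat n a * hmat n b = hmat n (a + b)"
proof (rule eq_matI)
  fix i j assume ij: "i < dim_row (hmat n (a + b))" "j < dim_col (hmat n (a + b))"
  then have ij': "i < Suc n" "j < Suc n" by auto
  have "(hmat n a * hmat n b) $$ (i, j) = (\<Sum>l<Suc n. hmat n a $$ (i, l) * hmat n b $$ (l, j))"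
    using ij' by (simp add: scalar_prod_def atLeast0LessThan)
  also have "\<dots> = (\<Sum>l<n. (if i = l then hmat n b $$ (l, j) else 0)) +
      hmat n a $$ (i, n) * hmat n b $$ (n, j)"
    using ij' unfolding sum.lessThan_Suc
    by (intro arg_cong2[where f = "(+)"] sum.cong) (auto simp: hmat_index)
  also have "\<dots> = hmat n (a + b) $$ (i, j)"
    using ij' by (auto simp: hmat_index sum.delta algebra_simps)
  finally show "(hmat n a * hmat n b) $$ (i, j) = hmat n (a + b) $$ (i, j)" .
qed auto

section \<open>Additive characters and hyperplanes\<close>

text \<open>The domain is a parameter so that a character of \<open>Fq n\<close> can be restricted
  to sections and hyperplanes.\<close>

definition additive_character :: "(nat \<Rightarrow> 'a::field) set \<Rightarrow> ((nat \<Rightarrow> 'a) \<Rightarrow> complex) \<Rightarrow> bool"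
  where "additive_character V c \<longleftrightarrow>
    (\<forall>a\<in>V. \<forall>b\<in>V. c (a + b) = c a * c b) \<and> (\<forall>a\<in>V. c a \<noteq> 0)"

lemma additive_character_subset:
  "additive_character V c \<Longrightarrow> W \<subseteq> V \<Longrightarrow> additive_character W c"
  unfolding additive_character_def by blast

lemma Nq_additive_character:
  assumes "\<chi> \<in> Nq n"
  shows "additive_character (Fq n) (\<lambda>a. \<chi> (hmat n a))" "\<exists>a\<in>Fq n. \<chi> (hmat n a) \<noteq> 1"
proof -
  have hom: "\<chi> \<in> hom (Hq (Suc n)) Cstar" using assms by (simp add: Nq_def)
  show "additive_character (Fq n) (\<lambda>a. \<chi> (hmat n a))"
    unfolding additive_character_def
  proof (intro conjI ballI)
    fix a b :: "nat \<Rightarrow> 'a" assume ab: "a \<in> Fq n" "b \<in> Fq n"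
    then have "\<chi> (hmat n a \<otimes>\<^bsub>Hq (Suc n)\<^esub> hmat n b) = \<chi> (hmat n a) \<otimes>\<^bsub>Cstar\<^esub> \<chi> (hmat n b)"
      using hom_mult[OF hom] by (simp add: carrier_Hq)
    moreover have "mult (Hq (Suc n)) = ((*) :: 'a mat \<Rightarrow> _)" by (simp add: Hq_def)
    ultimately show "\<chi> (hmat n (a + b)) = \<chi> (hmat n a) * \<chi> (hmat n b)"
      by (simp add: Cstar_def hmat_mult)
  next
    fix a :: "nat \<Rightarrow> 'a" assume "a \<in> Fq n"
    then have "hmat n a \<in> carrier (Hq (Suc n))" by (simp add: carrier_Hq)
    then show "\<chi> (hmat n a) \<noteq> 0" using hom by (auto simp: hom_def Cstar_def)
  qed
  show "\<exists>a\<in>Fq n. \<chi> (hmat n a) \<noteq> 1"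
    using assms by (auto simp: Nq_def carrier_Hq)
qed

lemma bij_betw_translate:
  assumes "fv.subspace V" "a \<in> V"
  shows "bij_betw ((+) a) V V"
  by (rule bij_betw_byWitness[where f' = "\<lambda>x. x - a"])
    (use assms in \<open>auto simp: fv.subspace_add fv.subspace_diff\<close>)

lemma additive_character_0:
  assumes "additive_character V c" "fv.subspace V"
  shows "c 0 = 1"
proof -
  have 0: "0 \<in> V" using assms(2) by (rule fv.subspace_0)
  then have "c (0 + 0) = c 0 * c 0" "c 0 \<noteq> 0"
    using assms(1) unfolding additive_character_def by blast+
  then show ?thesis by simp
qed

text \<open>Translation by \<open>a\<close> permutes \<open>V\<close>, so the product of all values
  of \<open>c\<close> equals itself times \<open>c a ^ card V\<close>; hence \<open>c a\<close> is a
  root of unity.\<close>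

lemma norm_additive_character:
  assumes V: "fv.subspace V" "finite V" and c: "additive_character V c" and a: "a \<in> V"
  shows "cmod (c a) = 1"
proof -
  have "(\<Prod>x\<in>V. c x) = (\<Prod>x\<in>V. c (a + x))"
    using prod.reindex_bij_betw[OF bij_betw_translate[OF V(1) a], of c] by simp
  also have "\<dots> = c a ^ card V * (\<Prod>x\<in>V. c x)"
    using c a by (simp add: additive_character_def prod.distrib)
  finally have "c a ^ card V = 1"
    using c V(2) by (simp add: additive_character_def)
  then have "cmod (c a) ^ card V = 1"
    by (metis norm_power norm_one)
  moreover have "card V > 0" using V a by (auto simp: card_gt_0_iff)
  ultimately show ?thesis by (metis norm_ge_zero power_eq_imp_eq_base power_one zero_le_one)
qed

text \<open>Orthogonality: translating by \<open>a\<close> multiplies the sum by \<open>c a\<close>,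
  so the sum vanishes as soon as some \<open>c a\<close> differs from 1.\<close>

lemma sum_additive_character:
  assumes V: "fv.subspace V" "finite V" and c: "additive_character V c"
  shows "(\<Sum>x\<in>V. c x) = (if \<forall>a\<in>V. c a = 1 then of_nat (card V) else 0)"
proof (cases "\<forall>a\<in>V. c a = 1")
  case False
  then obtain a where a: "a \<in> V" "c a \<noteq> 1" by blast
  have "(\<Sum>x\<in>V. c x) = (\<Sum>x\<in>V. c (a + x))"
    using sum.reindex_bij_betw[OF bij_betw_translate[OF V(1) a(1)], of c] by simp
  also have "\<dots> = c a * (\<Sum>x\<in>V. c x)"
    using c a by (simp add: additive_character_def sum_distrib_left)
  finally have "(\<Sum>x\<in>V. c x) = 0" using a(2) by simp
  then show ?thesis unfolding if_not_P[OF False] .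
qed simp

text \<open>A hyperplane for nonzero \<open>b\<close> in \<open>Fq n\<close>, and all of
  \<open>Fq n\<close> for \<open>b = 0\<close>. Between elements of \<open>Fq n\<close> the relation
  \<open>x \<in> perp n b\<close> is symmetric.\<close>

definition perp :: "nat \<Rightarrow> (nat \<Rightarrow> 'a::field) \<Rightarrow> (nat \<Rightarrow> 'a) set"
  where "perp n b = {x \<in> Fq n. (\<Sum>i<n. b i * x i) = 0}"

lemma perp_in_Bq: "perp n b \<in> Bq n"
  by (auto simp: perp_def subspaces_of_def fv.subspace_def Fq_def fscale_def ring_distribs
      sum.distrib mult.left_commute[of _ "_ :: 'a"] simp flip: sum_distrib_left)

lemma card_perp:
  fixes b :: "nat \<Rightarrow> 'a::{field,finite}"
  assumes "b \<in> Fq n" "b \<noteq> 0"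
  shows "CARD('a) ^ n = CARD('a) * card (perp n b)"
proof -
  obtain i where i: "b i \<noteq> 0" using assms(2) by (auto simp: fun_eq_iff)
  with assms(1) have "i < n" by (metis (mono_tags) Fq_def mem_Collect_eq not_le)
  \<comment> \<open>The unit vector at an index where \<open>b\<close> is nonzero serves as the
    vector outside the kernel.\<close>
  then have "(\<Sum>j<n. b j * unit_fun i j) = b i"
    by (simp add: unit_fun_def if_distrib[where f = "\<lambda>x. _ * x"] sum.delta cong: if_cong)
  then show ?thesis
    unfolding perp_def card_Fq[symmetric] using i unit_fun_in_Fq[OF \<open>i < n\<close>]
    by (intro card_functional_kernel[where v = "unit_fun i"])
      (auto simp: fv_subspace_Fq fscale_def ring_distribs sum.distrib sum_distrib_left mult_ac)
qed

lemma dim_perp: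
  fixes b :: "nat \<Rightarrow> 'a::{field,finite}"
  assumes "b \<in> Fq n" "b \<noteq> 0"
  shows "fv.dim (perp n b) = n - 1"
proof (rule dim_eqI)
  have "n \<noteq> 0" using assms by (auto simp: Fq_def fun_eq_iff)
  then obtain m where "n = Suc m" using not0_implies_Suc by blast
  then show "card (perp n b) = CARD('a) ^ (n - 1)"
    using card_perp[OF assms] by simp
qed (use perp_in_Bq BqD finite_in_Bq in blast)+

text \<open>The sum of \<open>c\<close> over \<open>perp n b\<close>, added up over all \<open>b\<close>, is \<open>q\<^sup>n - q\<^sup>n\<^sup>-\<^sup>1\<close>: a nonzero vector
  lies in \<open>perp n b\<close> for one \<open>q\<close>-th of all \<open>b\<close>, and \<open>c\<close> sums to zero. The term \<open>b = 0\<close> vanishes, so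
  another one does not.\<close>

lemma ex_perp_character_trivial:
  fixes c :: "(nat \<Rightarrow> 'a::{field,finite}) \<Rightarrow> complex"
  assumes c: "additive_character (Fq n) c" and nontriv: "\<exists>a\<in>Fq n. c a \<noteq> 1"
  obtains b where "b \<in> Fq n" "b \<noteq> 0" "\<forall>x\<in>perp n b. c x = 1"
proof (rule ccontr)
  assume "\<not> thesis"
  note contra = this and hyp = that
  have no: "\<not> (\<forall>x\<in>perp n b. c x = 1)" if "b \<in> Fq n" "b \<noteq> 0" for b
    using that hyp contra by blast
  have F0: "(\<Sum>x\<in>Fq n. c x) = 0"
    using nontriv by (subst sum_additive_character[OF fv_subspace_Fq _ c]) auto
  have perp0: "perp n (0 :: nat \<Rightarrow> 'a) = Fq n" by (simp add: perp_def)
  \<comment> \<open>By orthogonality the sum vanishes on each hyperplane, where \<open>c\<close> is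
    assumed nontrivial; for \<open>b = 0\<close> it runs over \<open>Fq n\<close>, where
    \<open>c\<close> is nontrivial by hypothesis.\<close>
  have "(\<Sum>x\<in>perp n b. c x) = 0" if "b \<in> Fq n" for b
  proof (cases "b = 0")
    case False
    have "additive_character (perp n b) c"
      using c by (rule additive_character_subset) (auto simp: perp_def)
    then show ?thesis
      using no[OF that False] perp_in_Bq[of n b] BqD finite_in_Bq
      by (subst sum_additive_character) auto
  qed (simp add: perp0 F0)
  then have "0 = (\<Sum>b\<in>Fq n. \<Sum>x\<in>perp n b. c x)" by simp
  \<comment> \<open>Symmetry of the bilinear form exchanges the roles of \<open>b\<close> and
    \<open>x\<close>.\<close>
  also have "\<dots> = (\<Sum>x\<in>Fq n. \<Sum>b\<in>perp n x. c x)"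
    unfolding perp_def by (subst sum.swap_restrict) (auto simp: mult.commute)
  also have "\<dots> = (\<Sum>x\<in>Fq n. c x * of_nat (card (perp n x)))" by (simp add: mult.commute)
  \<comment> \<open>The factor \<open>q\<close> lets \<open>card_perp\<close> apply without a
    division.\<close>
  finally have "0 = of_nat CARD('a) * (\<Sum>x\<in>Fq n. c x * of_nat (card (perp n x)))" by simp
  also have "\<dots> = (\<Sum>x\<in>Fq n. c x * of_nat (CARD('a) * card (perp n x)))"
    by (simp add: sum_distrib_left mult.left_commute)
  \<comment> \<open>The extra term at \<open>x = 0\<close> accounts for \<open>perp n 0\<close>
    being the whole space instead of a hyperplane.\<close>
  also have "\<dots> = (\<Sum>x\<in>Fq n. c x * of_nat (CARD('a) ^ n) +
      (if x = 0 then of_nat (CARD('a) ^ n) * of_nat (CARD('a) - 1) else 0))"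
  proof (rule sum.cong[OF refl])
    fix x :: "nat \<Rightarrow> 'a" assume x: "x \<in> Fq n"
    show "c x * of_nat (CARD('a) * card (perp n x)) = c x * of_nat (CARD('a) ^ n) +
      (if x = 0 then of_nat (CARD('a) ^ n) * of_nat (CARD('a) - 1) else 0)"
    proof (cases "x = 0")
      case True
      then show ?thesis
        using CARD_field_gt_1[where 'a='a] additive_character_0[OF c fv_subspace_Fq]
        by (simp add: perp0 card_Fq of_nat_diff algebra_simps)
    next
      case False
      then show ?thesis by (simp only: card_perp[OF x False, symmetric]) simp
    qed
  qed
  also have "\<dots> = of_nat (CARD('a) ^ n) * of_nat (CARD('a) - 1)"
    using fv.subspace_0[OF fv_subspace_Fq, of n, where 'b='a]
    by (simp add: sum.distrib F0 flip: sum_distrib_right)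
  also have "\<dots> \<noteq> 0" using CARD_field_gt_1[where 'a='a] by (simp del: of_nat_diff)
  finally show False by simp
qed

text \<open>If the hyperplanes differed, \<open>X\<close> and a vector \<open>v\<close> of
  \<open>X'\<close> outside it would span \<open>Fq n\<close> by counting, and \<open>c\<close>,
  being trivial on both, would be trivial throughout.\<close>

lemma hyperplane_kernel_unique:
  fixes c :: "(nat \<Rightarrow> 'a::{field,finite}) \<Rightarrow> complex"
  assumes c: "additive_character (Fq n) c" and nontriv: "\<exists>a\<in>Fq n. c a \<noteq> 1"
    and X: "X \<in> Bq n" "fv.dim X = n - 1" "\<forall>x\<in>X. c x = 1"
    and X': "X' \<in> Bq n" "fv.dim X' = n - 1" "\<forall>x\<in>X'. c x = 1"
  shows "X = X'"
proof (rule ccontr)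
  assume ne: "X \<noteq> X'"
  have sX: "fv.subspace X" "fv.subspace X'" "X \<subseteq> Fq n" "X' \<subseteq> Fq n" "finite X" "finite X'"
    using X X' BqD finite_in_Bq by blast+
  have cX: "card X = CARD('a) ^ (n - 1)" "card X' = CARD('a) ^ (n - 1)"
    using card_subspace sX X X' by metis+
  then have "\<not> X' \<subseteq> X" using card_subset_eq[OF sX(5), of X'] ne by auto
  then obtain v where v: "v \<in> X'" "v \<notin> X" by blast
  \<comment> \<open>Guards against the truncated \<open>n - 1\<close>: the count below multiplies
    \<open>q^(n-1)\<close> by \<open>q\<close> to reach \<open>q^n\<close>.\<close>
  have n: "n \<noteq> 0"
  proof
    assume "n = 0"
    then have "Fq n = {0 :: nat \<Rightarrow> 'a}" by (auto simp: Fq_def)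
    then show False using v sX fv.subspace_0[of X] by auto
  qed
  have inj: "inj_on (\<lambda>p. fscale (fst p) v + snd p) (UNIV \<times> X)"
  proof (rule inj_onI, clarsimp)
    fix s t x y assume xy: "x \<in> X" "y \<in> X" and eq: "fscale s v + x = fscale t v + y"
    have eq': "fscale (s - t) v = y - x"
      using eq by (simp add: fv.scale_left_diff_distrib algebra_simps)
    have "s = t"
    proof (rule ccontr)
      assume "s \<noteq> t"
      then have "v = fscale (inverse (s - t)) (y - x)" by (simp flip: eq')
      then show False using xy v(2) sX(1) by (auto intro: fv.subspace_scale fv.subspace_diff)
    qed
    with eq show "s = t \<and> x = y" by simp
  qed
  let ?I = "(\<lambda>p. fscale (fst p) v + snd p) ` (UNIV \<times> X)"
  have "?I \<subseteq> Fq n"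
    using sX v by (auto intro!: fv.subspace_add fv.subspace_scale fv_subspace_Fq)
  moreover have "card ?I = card (Fq n :: (nat \<Rightarrow> 'a) set)"
    using n by (simp add: card_image[OF inj] card_cartesian_product cX card_Fq flip: power_Suc)
  ultimately have I: "?I = Fq n" by (intro card_subset_eq) auto
  obtain a where a: "a \<in> Fq n" "c a \<noteq> 1" using nontriv by blast
  then obtain t x where tx: "x \<in> X" "a = fscale t v + x" using I by fastforce
  have tv: "fscale t v \<in> X'" using v sX by (intro fv.subspace_scale)
  then have "c a = c (fscale t v) * c x"
    using tx c sX unfolding additive_character_def by blast
  then show False using tx tv X X' a by simp
qed

section \<open>The hyperplane of a character\<close>

lemma hat_eq_lift_space: "fv.subspace Z \<Longrightarrow> Z \<subseteq> Fq n \<Longrightarrow> hat n Z = lift_space n Z 0"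
proof (intro Set.set_eqI iffI)
  fix y assume Z: "fv.subspace Z" "Z \<subseteq> Fq n"
  have sp: "fv.span Z = Z" using Z(1) by (simp add: fv.span_eq_iff)
  {
    assume "y \<in> hat n Z"
    then obtain k where k: "y - fscale k (unit_fun n) \<in> Z"
      by (auto simp: hat_def fv.span_insert sp)
    then have "(y - fscale k (unit_fun n)) n = 0" using Z(2) by (auto simp: Fq_def)
    then have "k = y n" by (simp add: fscale_def unit_fun_def)
    then show "y \<in> lift_space n Z 0" using k by (simp add: lift_space_def)
  next
    assume "y \<in> lift_space n Z 0"
    then show "y \<in> hat n Z" by (auto simp: hat_def fv.span_insert sp lift_space_def)
  }
qed

text \<open>The matrix fixes \<open>Z\<close> pointwise and sends \<open>unit_fun n\<close> to
  \<open>unit_fun n + a\<close>; as \<open>a\<close> varies, the hat runs through all lifts of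
  \<open>Z\<close>.\<close>

lemma mat_act_hmat_hat:
  assumes Z: "Z \<in> Bq n" and a: "a \<in> Fq n"
  shows "mat_act (hmat n a) ` hat n Z = lift_space n Z a"
proof -
  have an: "a n = 0" using a by (simp add: Fq_def)
  have hat: "hat n Z = lift_space n Z 0" by (intro hat_eq_lift_space BqD[OF Z])
  have sub: "lift_space n Z 0 \<subseteq> Fq (Suc n)"
    using lift_space_in_Aq(1)[OF Z, of 0] fv.subspace_0[OF fv_subspace_Fq] AqD(1) BqD(2) by blast
  have "mat_act (hmat n a) ` lift_space n Z 0 = (\<lambda>x. x + fscale (x n) a) ` lift_space n Z 0"
    using sub a by (intro image_cong) (auto simp: mat_act_hmat)
  also have "\<dots> = lift_space n Z a"
  proof (intro Set.set_eqI iffI)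
    fix y assume "y \<in> lift_space n Z a"
    then have "y - fscale (y n) a \<in> lift_space n Z 0"
      by (simp add: lift_space_def an fscale_def[of _ a] algebra_simps)
    then show "y \<in> (\<lambda>x. x + fscale (x n) a) ` lift_space n Z 0"
      by (intro image_eqI[where x = "y - fscale (y n) a"]) (simp_all add: fscale_def an)
  next
    fix y assume "y \<in> (\<lambda>x. x + fscale (x n) a) ` lift_space n Z 0"
    then obtain x where "y = x + fscale (x n) a" "x \<in> lift_space n Z 0" by blast
    then show "y \<in> lift_space n Z a"
      by (simp add: lift_space_def an fscale_def algebra_simps plus_fun_def fun_diff_def)
  qed
  finally show ?thesis by (simp add: hat)
qed

lemma pchi_hat_apply:
  fixes Z :: "(nat \<Rightarrow> 'a::{field,finite}) set"
  assumes Z: "Z \<in> Bq n"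
  shows "pchi n \<chi> (basis_vec (hat n Z)) Y =
    (\<Sum>a | a \<in> Fq n \<and> lift_space n Z a = Y. cnj (\<chi> (hmat n a)))"
proof -
  have "hat n Z \<in> Aq (Suc n)"
    using lift_space_in_Aq(1)[OF Z fv.subspace_0[OF fv_subspace_Fq]] hat_eq_lift_space Z BqD
    by metis
  then have "pchi n \<chi> (basis_vec (hat n Z)) Y =
      (\<Sum>a\<in>Fq n. cnj (\<chi> (hmat n a)) * basis_vec (lift_space n Z a) Y)"
    by (simp add: pchi_def carrier_Hq sum_fun_apply sum.reindex[OF inj_on_hmat] group_act_def
        lin_ext_basis_vec mat_act_hmat_hat[OF Z] fscale_def)
  also have "\<dots> = (\<Sum>a | a \<in> Fq n \<and> lift_space n Z a = Y. cnj (\<chi> (hmat n a)))"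
    by (rule sum.mono_neutral_cong_right) (auto simp: basis_vec_def)
  finally show ?thesis .
qed

lemma pchi_hat_eq_0:
  fixes Z :: "(nat \<Rightarrow> 'a::{field,finite}) set"
  assumes Z: "Z \<in> Bq n" and Y: "\<not> (Y \<in> Aq (Suc n) \<and> Y \<inter> Fq n = Z)"
  shows "pchi n \<chi> (basis_vec (hat n Z)) Y = 0"
  unfolding pchi_hat_apply[OF Z] using lift_space_in_Aq[OF Z] Y by (intro sum.neutral) auto

text \<open>The group elements taking the hat to \<open>Y\<close> form the coset of \<open>w\<close>
  modulo the section; multiplicativity pulls out \<open>w\<close>, and orthogonality evaluates the
  rest.\<close>

lemma pchi_hat:
  fixes Y :: "(nat \<Rightarrow> 'a::{field,finite}) set"
  assumes \<chi>: "\<chi> \<in> Nq n" and Y: "Y \<in> Aq (Suc n)" and w: "w \<in> Fq n" "unit_fun n + w \<in> Y"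
  shows "pchi n \<chi> (basis_vec (hat n (Y \<inter> Fq n))) Y =
    (if \<forall>z\<in>Y \<inter> Fq n. \<chi> (hmat n z) = 1
     then cnj (\<chi> (hmat n w)) * of_nat (CARD('a) ^ fv.dim (Y \<inter> Fq n)) else 0)"
proof -
  note Z = Aq_section[OF Y]
  note c = Nq_additive_character(1)[OF \<chi>]
  have sZ: "fv.subspace (Y \<inter> Fq n)" "finite (Y \<inter> Fq n)" using Z BqD finite_in_Bq by blast+
  have "pchi n \<chi> (basis_vec (hat n (Y \<inter> Fq n))) Y = (\<Sum>a\<in>(+) w ` (Y \<inter> Fq n). cnj (\<chi> (hmat n a)))"
    unfolding pchi_hat_apply[OF Z] lift_space_fibre[OF Y w] ..
  also have "\<dots> = (\<Sum>z\<in>Y \<inter> Fq n. cnj (\<chi> (hmat n (w + z))))"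
    by (subst sum.reindex) auto
  also have "\<dots> = (\<Sum>z\<in>Y \<inter> Fq n. cnj (\<chi> (hmat n w)) * cnj (\<chi> (hmat n z)))"
    using c w by (intro sum.cong) (auto simp: additive_character_def)
  also have "\<dots> = cnj (\<chi> (hmat n w)) * cnj (\<Sum>z\<in>Y \<inter> Fq n. \<chi> (hmat n z))"
    by (simp add: sum_distrib_left)
  also have "(\<Sum>z\<in>Y \<inter> Fq n. \<chi> (hmat n z)) = (if \<forall>z\<in>Y \<inter> Fq n. \<chi> (hmat n z) = 1
      then of_nat (card (Y \<inter> Fq n)) else 0)"
    using c by (intro sum_additive_character sZ additive_character_subset[OF c]) auto
  finally show ?thesis by (simp add: card_subspace[OF sZ] split: if_splits)
qed

text \<open>Nonvanishing of \<open>pchi\<close> on the hat of \<open>X\<close> forces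
  \<open>\<chi>\<close> to be trivial on \<open>X\<close>, and only one hyperplane has that
  property. Knowing it as a \<open>perp\<close> gives access to its Schubert form.\<close>

lemma Xchi_eq_perp:
  fixes \<chi> :: "'a::{field,finite} mat \<Rightarrow> complex"
  assumes \<chi>: "\<chi> \<in> Nq n"
  obtains b where "b \<in> Fq n" "b \<noteq> 0" "Xchi n \<chi> = perp n b" "\<forall>x\<in>perp n b. \<chi> (hmat n x) = 1"
proof -
  note c = Nq_additive_character[OF \<chi>]
  obtain b where b: "b \<in> Fq n" "b \<noteq> 0" "\<forall>x\<in>perp n b. \<chi> (hmat n x) = 1"
    using ex_perp_character_trivial[OF c] by blast
  have trivial: "\<forall>x\<in>X. \<chi> (hmat n x) = 1"
    if X: "X \<in> Bq n" and ne: "pchi n \<chi> (basis_vec (hat n X)) \<noteq> 0" for X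
  proof -
    \<comment> \<open>A nonzero coordinate occurs only at a lift of \<open>X\<close>, where
      \<open>pchi_hat\<close> evaluates it.\<close>
    obtain Y where Y: "pchi n \<chi> (basis_vec (hat n X)) Y \<noteq> 0"
      using ne by (auto simp: fun_eq_iff)
    then have Y': "Y \<in> Aq (Suc n)" "Y \<inter> Fq n = X" using pchi_hat_eq_0[OF X] by blast+
    obtain w where w: "w \<in> Fq n" "unit_fun n + w \<in> Y" using Aq_obtain_lift[OF Y'(1)] .
    show ?thesis using pchi_hat[OF \<chi> Y'(1) w] Y Y'(2) by (auto split: if_splits)
  qed
  have "Xchi n \<chi> = perp n b"
    unfolding Xchi_def
  proof (rule the_equality, intro conjI)
    show "perp n b \<in> Bq n" by (rule perp_in_Bq)
    show "fv.dim (perp n b) = n - 1" using b by (simp add: dim_perp)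
    \<comment> \<open>The coordinate at the lift with \<open>w = 0\<close>, which is the hat itself,
      is a power of \<open>q\<close> because \<open>\<chi> (hmat n 0) = 1\<close>.\<close>
    note Y = lift_space_in_Aq[OF perp_in_Bq[of n b] fv.subspace_0[OF fv_subspace_Fq]]
    have "\<chi> (hmat n 0) = 1" using additive_character_0[OF c(1) fv_subspace_Fq] .
    then have "pchi n \<chi> (basis_vec (hat n (perp n b))) (lift_space n (perp n b) 0) \<noteq> 0"
      using pchi_hat[OF \<chi> Y(1) fv.subspace_0[OF fv_subspace_Fq] Y(3)] b(3) by (simp add: Y(2))
    then show "pchi n \<chi> (basis_vec (hat n (perp n b))) \<noteq> 0" by (auto simp: fun_eq_iff)
  next
    fix X assume "X \<in> Bq n \<and> fv.dim X = n - 1 \<and> pchi n \<chi> (basis_vec (hat n X)) \<noteq> 0"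
    then show "X = perp n b"
      using b by (intro hyperplane_kernel_unique[OF c _ _ trivial perp_in_Bq])
        (auto simp: dim_perp)
  qed
  then show thesis using that b by blast
qed

section \<open>Schubert normal form\<close>

lemma mat_act_add: "mat_act M (x + y) = mat_act M x + mat_act M y"
  by (rule ext) (simp add: mat_act_apply ring_distribs sum.distrib)

lemma mat_act_scale: "mat_act M (fscale c x) = fscale c (mat_act M x)"
  for c :: "'a::field"
  by (rule ext) (simp add: mat_act_apply fscale_def sum_distrib_left mult.left_commute)

lemma mat_act_0: "mat_act M 0 = (0 :: nat \<Rightarrow> 'a::field)"
  by (rule ext) (simp add: mat_act_apply)

lemma mat_act_unit_fun:
  fixes M :: "'a::field mat"
  assumes "j < dim_col M"
  shows "mat_act M (unit_fun j) = pad_vec (col M j)"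
proof (rule ext)
  fix i
  have "(\<Sum>l<dim_col M. M $$ (i, l) * unit_fun j l) = M $$ (i, j)"
    using assms
    by (simp add: unit_fun_def if_distrib[where f = "\<lambda>x. _ * x"] sum.delta cong: if_cong)
  then show "mat_act M (unit_fun j) i = pad_vec (col M j) i"
    using assms by (simp add: mat_act_apply pad_vec_def)
qed

lemma mat_act_eq_sum:
  fixes M :: "'a::field mat"
  shows "mat_act M x = (\<Sum>j<dim_col M. fscale (x j) (pad_vec (col M j)))"
  by (rule ext) (simp add: mat_act_apply sum_fun_apply fscale_def pad_vec_def mult.commute)

lemma subspace_mat_act_image:
  fixes M :: "'a::field mat"
  assumes "fv.subspace V"
  shows "fv.subspace (mat_act M ` V)"
  unfolding fv.subspace_def
proof (intro conjI ballI allI)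
  show "0 \<in> mat_act M ` V"
    using fv.subspace_0[OF assms] mat_act_0[of M] by (metis imageI)
next
  fix x y assume "x \<in> mat_act M ` V" "y \<in> mat_act M ` V"
  then show "x + y \<in> mat_act M ` V"
    using fv.subspace_add[OF assms] by (auto simp flip: mat_act_add)
next
  fix c x assume "x \<in> mat_act M ` V"
  then show "fscale c x \<in> mat_act M ` V"
    using fv.subspace_scale[OF assms] by (auto simp flip: mat_act_scale)
qed

lemma mat_act_image_Fq:
  fixes M :: "'a::field mat"
  shows "mat_act M ` Fq (dim_col M) = column_space M"
proof
  show "mat_act M ` Fq (dim_col M) \<subseteq> column_space M"
    unfolding column_space_def mat_act_eq_sum
    by (auto intro!: fv.span_sum fv.span_scale intro: fv.span_base)
  show "column_space M \<subseteq> mat_act M ` Fq (dim_col M)"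
    unfolding column_space_def
  proof (rule fv.span_minimal)
    show "{pad_vec (col M j) |j. j < dim_col M} \<subseteq> mat_act M ` Fq (dim_col M)"
      using mat_act_unit_fun[of _ M] unit_fun_in_Fq by (force simp: image_iff)
  qed (intro subspace_mat_act_image fv_subspace_Fq)
qed

text \<open>The body of the existential in \<open>schubert_form\<close>, with the pivot rows as a
  parameter so that those of two matrices can be compared.\<close>

definition schubert_pivots :: "nat \<Rightarrow> nat \<Rightarrow> 'a::field mat \<Rightarrow> (nat \<Rightarrow> nat) \<Rightarrow> bool"
  where "schubert_pivots n k M r \<longleftrightarrow> strict_mono_on {..<k} r \<and>
      (\<forall>j<k. r j < n \<and> M $$ (r j, j) = 1 \<and> (\<forall>i. r j < i \<and> i < n \<longrightarrow> M $$ (i, j) = 0)) \<and>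
      (\<forall>i<k. \<forall>j<k. M $$ (r i, j) = (if i = j then 1 else 0))"

lemma schubert_form_iff:
  "schubert_form n k M \<longleftrightarrow> M \<in> carrier_mat n k \<and> (\<exists>r. schubert_pivots n k M r)"
  by (simp add: schubert_form_def schubert_pivots_def)

text \<open>The pivot rows form an identity matrix, so the coefficients of a combination of columns
  can be read off there. Injectivity and uniqueness both rest on this.\<close>

lemma mat_act_at_pivot:
  assumes M: "M \<in> carrier_mat n k" and r: "schubert_pivots n k M r" and i: "i < k"
  shows "mat_act M x (r i) = x i"
proof -
  have "r i < n" using r i by (auto simp: schubert_pivots_def)
  then have "mat_act M x (r i) = (\<Sum>j<k. M $$ (r i, j) * x j)"
    using M by (simp add: mat_act_apply)
  also have "\<dots> = (\<Sum>j<k. if i = j then x j else 0)"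
    using r i by (intro sum.cong) (auto simp: schubert_pivots_def)
  also have "\<dots> = x i" using i by (simp add: sum.delta)
  finally show ?thesis .
qed

lemma inj_on_mat_act_schubert:
  assumes "schubert_form n k M"
  shows "inj_on (mat_act M) (Fq k)"
proof -
  obtain r where M: "M \<in> carrier_mat n k" and r: "schubert_pivots n k M r"
    using assms by (auto simp: schubert_form_iff)
  show ?thesis
  proof (rule inj_onI, rule ext)
    fix x y i assume xy: "x \<in> Fq k" "y \<in> Fq k" "mat_act M x = mat_act M y"
    then show "x i = y i"
      using mat_act_at_pivot[OF M r, of i x] mat_act_at_pivot[OF M r, of i y]
      by (cases "i < k") (auto simp: Fq_def)
  qed
qed

lemma mat_act_cong: "(\<And>j. j < dim_col M \<Longrightarrow> x j = y j) \<Longrightarrow> mat_act M x = mat_act M y"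
  by (rule ext) (auto simp: mat_act_apply intro: sum.cong)

text \<open>The pivot rows are exactly the positions of the last nonzero entries of the nonzero vectors
  of the column space; hence the column space determines them.\<close>

lemma schubert_pivots_image:
  assumes M: "M \<in> carrier_mat n k" and r: "schubert_pivots n k M r"
  shows "r ` {..<k} = {l. \<exists>x\<in>column_space M. x l \<noteq> 0 \<and> (\<forall>i>l. x i = 0)}"
proof (intro Set.set_eqI iffI)
  fix l assume "l \<in> r ` {..<k}"
  then obtain j where j: "j < k" "l = r j" by blast
  have "pad_vec (col M j) \<in> column_space M"
    using M j by (auto simp: column_space_def intro: fv.span_base)
  moreover have "pad_vec (col M j) l \<noteq> 0" "\<forall>i>l. pad_vec (col M j) i = 0"
    using M r j by (auto simp: pad_vec_def schubert_pivots_def)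
  ultimately show "l \<in> {l. \<exists>x\<in>column_space M. x l \<noteq> 0 \<and> (\<forall>i>l. x i = 0)}" by blast
next
  fix l assume "l \<in> {l. \<exists>x\<in>column_space M. x l \<noteq> 0 \<and> (\<forall>i>l. x i = 0)}"
  then obtain a where x0: "mat_act M a l \<noteq> 0" and above: "\<forall>i>l. mat_act M a i = 0"
    by (auto simp flip: mat_act_image_Fq)
  \<comment> \<open>The last column with a nonzero coefficient decides where the combination has its
    last nonzero entry, namely in the pivot row of that column.\<close>
  let ?S = "{j. j < k \<and> a j \<noteq> 0}"
  have "?S \<noteq> {}"
  proof
    assume "?S = {}"
    then have "mat_act M a = mat_act M 0" using M by (intro mat_act_cong) auto
    then show False using x0 by (simp add: mat_act_0)
  qed
  then have J: "Max ?S \<in> ?S" by (intro Max_in) auto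
  then have Jk: "Max ?S < k" and aJ: "a (Max ?S) \<noteq> 0" by auto
  have xJ: "mat_act M a (r (Max ?S)) \<noteq> 0"
    using aJ by (simp add: mat_act_at_pivot[OF M r Jk])
  have "mat_act M a i = 0" if i: "i > r (Max ?S)" for i
  proof (cases "i < n")
    case True
    \<comment> \<open>Columns after \<open>Max ?S\<close> have coefficient zero; the others vanish
      below their pivots, whose row indices are at most \<open>r (Max ?S)\<close>.\<close>
    have "M $$ (i, j) * a j = 0" if j: "j < k" for j
    proof (cases "a j = 0")
      case False
      then have "j \<le> Max ?S" using j by (intro Max_ge) auto
      then have "r j \<le> r (Max ?S)"
        using r j Jk by (auto simp: schubert_pivots_def strict_mono_on_leD)
      then show ?thesis using r j i True by (auto simp: schubert_pivots_def)
    qed simp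
    then have "(\<Sum>j<k. M $$ (i, j) * a j) = 0" by (intro sum.neutral) blast
    then show ?thesis using M by (simp add: mat_act_apply)
  next
    case False
    then show ?thesis using M by (simp add: mat_act_apply)
  qed
  then have "l = r (Max ?S)" using xJ x0 above by (metis nat_neq_iff)
  then show "l \<in> r ` {..<k}" using Jk by blast
qed

text \<open>If two increasing enumerations of one set agree before \<open>j\<close>, then
  \<open>u j\<close> is some \<open>t i\<close> with \<open>i\<close> not below \<open>j\<close>, so
  \<open>t j \<le> u j\<close>; exchanging the roles gives equality.\<close>

lemma strict_mono_on_image_eq:
  fixes r s :: "nat \<Rightarrow> nat"
  assumes r: "strict_mono_on {..<k} r" and s: "strict_mono_on {..<k} s"
    and eq: "r ` {..<k} = s ` {..<k}"
  shows "j < k \<Longrightarrow> r j = s j"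
proof (induction j rule: less_induct)
  case (less j)
  have le: "t j \<le> u j" if tu: "strict_mono_on {..<k} t" "strict_mono_on {..<k} u"
    "u ` {..<k} = t ` {..<k}" "\<forall>i<j. t i = u i" for t u :: "nat \<Rightarrow> nat"
  proof -
    obtain i where i: "i < k" "u j = t i" using tu(3) less.prems by blast
    have "j \<le> i"
    proof (rule ccontr)
      assume "\<not> j \<le> i"
      then have "t i < u j" using strict_mono_onD[OF tu(2), of i j] i less.prems tu(4) by auto
      then show False using i by simp
    qed
    then show ?thesis using strict_mono_on_leD[OF tu(1), of j i] i less.prems by auto
  qed
  show ?case
    using le[OF r s] le[OF s r] eq less by (intro antisym) auto
qed

text \<open>The pivots agree by \<open>schubert_pivots_image\<close>. A column of \<open>M'\<close>
  is a combination of columns of \<open>M\<close>, and its entries in the pivot rows show that the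
  coefficients are those of a unit vector.\<close>

lemma schubert_form_unique:
  assumes "schubert_form n k M" "schubert_form n k M'" "column_space M = column_space M'"
  shows "M = M'"
proof -
  obtain r r' where M: "M \<in> carrier_mat n k" and r: "schubert_pivots n k M r"
    and M': "M' \<in> carrier_mat n k" and r': "schubert_pivots n k M' r'"
    using assms by (auto simp: schubert_form_iff)
  have "r ` {..<k} = r' ` {..<k}"
    using schubert_pivots_image[OF M r] schubert_pivots_image[OF M' r'] assms(3) by simp
  then have rr: "r j = r' j" if "j < k" for j
    using strict_mono_on_image_eq that r r' unfolding schubert_pivots_def by blast
  have "pad_vec (col M' j) = pad_vec (col M j)" if j: "j < k" for j
  proof -
    have "pad_vec (col M' j) \<in> column_space M"
      using M' j assms(3) by (auto simp: column_space_def intro: fv.span_base)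
    then obtain a where a: "a \<in> Fq k" "pad_vec (col M' j) = mat_act M a"
      using M by (auto simp flip: mat_act_image_Fq)
    have "a i = unit_fun j i" if i: "i < k" for i
    proof -
      have "a i = pad_vec (col M' j) (r' i)"
        using mat_act_at_pivot[OF M r i, of a] by (simp add: a(2) rr i)
      also have "\<dots> = unit_fun j i"
        using M' r' i j by (simp add: pad_vec_def schubert_pivots_def unit_fun_def)
      finally show ?thesis .
    qed
    then have "mat_act M a = mat_act M (unit_fun j)"
      using M by (intro mat_act_cong) auto
    then show ?thesis using a M j by (simp add: mat_act_unit_fun)
  qed
  then have pad_eq: "pad_vec (col M' j) i = pad_vec (col M j) i" if "j < k" for i j
    using that by simp
  have "M $$ (i, j) = M' $$ (i, j)" if "i < n" "j < k" for i j
    using pad_eq[OF that(2), of i] that M M' by (simp add: pad_vec_def)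
  then show ?thesis
    using M M' by (intro eq_matI) auto
qed

lemma ex_schubert_form_perp:
  fixes b :: "nat \<Rightarrow> 'a::{field,finite}"
  assumes b: "b \<in> Fq n" "b \<noteq> 0"
  shows "\<exists>M. schubert_form n (n - 1) M \<and> column_space M = perp n b"
proof -
  \<comment> \<open>The equation of the hyperplane is solved for the first coordinate that occurs in
    it. Row \<open>s\<close> is then the row without a pivot, and its nonzero entries lie above the
    pivots of their columns.\<close>
  define s where "s = (LEAST i. b i \<noteq> 0)"
  have "\<exists>i. b i \<noteq> 0" using b(2) by (auto simp: fun_eq_iff)
  then have bs: "b s \<noteq> 0" unfolding s_def by (rule LeastI_ex)
  have below: "b i = 0" if "i < s" for i using not_less_Least that unfolding s_def by blast
  have sn: "s < n" using b(1) bs by (metis (mono_tags) Fq_def mem_Collect_eq not_le)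
  \<comment> \<open>For \<open>j < s\<close> the unit vector itself satisfies the equation; from
    \<open>s\<close> on, the unit vector at \<open>Suc j\<close> is corrected in row
    \<open>s\<close>.\<close>
  define M where "M = mat n (n - 1) (\<lambda>(i, j). if j < s then if i = j then 1 else 0
     else if i = Suc j then 1 else if i = s then - b (Suc j) / b s else 0)"
  have M: "M \<in> carrier_mat n (n - 1)" by (simp add: M_def)
  have "schubert_pivots n (n - 1) M (\<lambda>j. if j < s then j else Suc j)"
    using sn by (auto simp: schubert_pivots_def M_def strict_mono_on_def)
  then have S: "schubert_form n (n - 1) M" using M by (auto simp: schubert_form_iff)
  have "{pad_vec (col M j) |j. j < dim_col M} \<subseteq> perp n b"
  proof clarify
    fix j assume "j < dim_col M"
    then have j: "j < n - 1" using M by simp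
    have "(\<Sum>i<n. b i * pad_vec (col M j) i) = (\<Sum>i<n. if j < s then if i = j then b i else 0
        else (if i = Suc j then b i else 0) + (if i = s then - b (Suc j) else 0))"
      using j bs by (intro sum.cong) (auto simp: pad_vec_def M_def)
    also have "\<dots> = 0"
      using j sn below by (cases "j < s") (auto simp: sum.distrib sum.delta)
    finally show "pad_vec (col M j) \<in> perp n b"
      using M by (auto simp: perp_def Fq_def pad_vec_def)
  qed
  then have "column_space M \<subseteq> perp n b"
    unfolding column_space_def using perp_in_Bq[of n b] BqD by (intro fv.span_minimal) auto
  moreover have "card (column_space M) = card (perp n b)"
  proof -
    have "card (column_space M) = card (Fq (n - 1) :: (nat \<Rightarrow> 'a) set)"
      using card_image[OF inj_on_mat_act_schubert[OF S]] M mat_act_image_Fq[of M] by simp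
    also have "\<dots> = CARD('a) ^ fv.dim (perp n b)" by (simp add: card_Fq dim_perp[OF b])
    also have "\<dots> = card (perp n b)"
      using perp_in_Bq[of n b] by (intro card_subspace[symmetric] BqD finite_in_Bq)
    finally show ?thesis .
  qed
  ultimately have "column_space M = perp n b"
    using perp_in_Bq[of n b] finite_in_Bq by (intro card_subset_eq)
  then show ?thesis using S by blast
qed

lemma schubert_mat_perp:
  fixes b :: "nat \<Rightarrow> 'a::{field,finite}"
  assumes "b \<in> Fq n" "b \<noteq> 0"
  shows "schubert_form n (n - 1) (schubert_mat n (perp n b))"
    "column_space (schubert_mat n (perp n b)) = perp n b"
proof -
  have "\<exists>!M. schubert_form n (n - 1) M \<and> column_space M = perp n b"
    using ex_schubert_form_perp[OF assms] schubert_form_unique by blast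
  from theI'[OF this] show "schubert_form n (n - 1) (schubert_mat n (perp n b))"
    "column_space (schubert_mat n (perp n b)) = perp n b"
    unfolding schubert_mat_def by blast+
qed

section \<open>The isomorphism from \<open>Fq (n - 1)\<close> onto the hyperplane\<close>

lemma bij_betw_tau:
  fixes b :: "nat \<Rightarrow> 'a::{field,finite}"
  assumes "b \<in> Fq n" "b \<noteq> 0"
  shows "bij_betw (tau n (perp n b)) (Fq (n - 1)) (perp n b)"
proof -
  note S = schubert_mat_perp[OF assms]
  have "dim_col (schubert_mat n (perp n b)) = n - 1" using S(1) by (auto simp: schubert_form_def)
  then show ?thesis
    using inj_on_mat_act_schubert[OF S(1)] mat_act_image_Fq[of "schubert_mat n (perp n b)"] S(2)
    by (simp add: bij_betw_def tau_def)
qed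

lemma tau_image_bij_betw:
  assumes bij: "bij_betw (tau n X) (Fq m) X"
  shows "bij_betw ((`) (tau n X)) (Bq m) (subspaces_of X)"
    "\<And>Z. Z \<subseteq> X \<Longrightarrow> tau n X ` (inv_into (Fq m) (tau n X) ` Z) = Z"
    "\<And>Z. Z \<in> subspaces_of X \<Longrightarrow> inv_into (Fq m) (tau n X) ` Z \<in> Bq m"
proof -
  have inj: "inj_on (tau n X) (Fq m)" and im: "tau n X ` Fq m = X"
    using bij by (auto simp: bij_betw_def)
  show ti: "tau n X ` (inv_into (Fq m) (tau n X) ` Z) = Z" if "Z \<subseteq> X" for Z
    using that im by (intro image_inv_into_cancel) auto
  have it: "inv_into (Fq m) (tau n X) ` (tau n X ` W) = W" if "W \<subseteq> Fq m" for W
    using that inj by (intro inv_into_image_cancel)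
  show sub: "inv_into (Fq m) (tau n X) ` Z \<in> Bq m" if Z: "Z \<in> subspaces_of X" for Z
  proof -
    have ZX: "fv.subspace Z" "Z \<subseteq> X" using Z by (auto simp: subspaces_of_def)
    have "tau n X ` {x \<in> Fq m. tau n X x \<in> Z} = Z" using ZX(2) im by auto
    \<comment> \<open>Written as a preimage under the linear map, the set is visibly a
      subspace.\<close>
    then have "inv_into (Fq m) (tau n X) ` Z = {x \<in> Fq m. tau n X x \<in> Z}"
      using it[of "{x \<in> Fq m. tau n X x \<in> Z}"] by simp
    moreover have "fv.subspace {x \<in> Fq m. tau n X x \<in> Z}"
      using ZX(1) fv_subspace_Fq[of m, where 'a='a]
      by (auto simp: fv.subspace_def tau_def mat_act_0 mat_act_add mat_act_scale)
    ultimately show ?thesis by (auto simp: subspaces_of_def)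
  qed
  show "bij_betw ((`) (tau n X)) (Bq m) (subspaces_of X)"
  proof (rule bij_betw_byWitness[where f' = "\<lambda>Z. inv_into (Fq m) (tau n X) ` Z"])
    show "(`) (tau n X) ` Bq m \<subseteq> subspaces_of X"
      using im subspace_mat_act_image unfolding tau_def subspaces_of_def by blast
    show "(\<lambda>Z. inv_into (Fq m) (tau n X) ` Z) ` subspaces_of X \<subseteq> Bq m"
      using sub by blast
  qed (simp_all add: it ti subspaces_of_def)
qed

lemma dim_tau_image:
  fixes X :: "(nat \<Rightarrow> 'a::{field,finite}) set"
  assumes bij: "bij_betw (tau n X) (Fq m) X" and W: "W \<in> Bq m"
  shows "fv.dim (tau n X ` W) = fv.dim W"
proof (rule dim_eqI)
  have "inj_on (tau n X) W"
    using bij BqD(2)[OF W] by (auto simp: bij_betw_def intro: inj_on_subset)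
  then show "card (tau n X ` W) = CARD('a) ^ fv.dim W"
    using card_subspace[OF BqD(1)[OF W] finite_in_Bq[OF W]] by (simp add: card_image)
  show "fv.subspace (tau n X ` W)"
    unfolding tau_def using W by (intro subspace_mat_act_image BqD)
qed (use finite_in_Bq[OF W] in simp)

section \<open>Coordinates of the vectors\<close>

lemma fscale_apply: "fscale c f i = c * f i"
  by (simp add: fscale_def)

lemma mu_apply:
  fixes X :: "(nat \<Rightarrow> 'a::{field,finite}) set"
  assumes bij: "bij_betw (tau n X) (Fq (n - 1)) X" and Z: "Z \<in> subspaces_of X"
  shows "mu n X u Z = u (inv_into (Fq (n - 1)) (tau n X) ` Z)"
proof -
  let ?W = "inv_into (Fq (n - 1)) (tau n X) ` Z"
  note t = tau_image_bij_betw[OF bij]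
  have W: "?W \<in> Bq (n - 1)" "tau n X ` ?W = Z"
    using t(2,3) Z by (auto simp: subspaces_of_def)
  have "Z = tau n X ` W \<longleftrightarrow> W = ?W" if "W \<in> Bq (n - 1)" for W
    using inj_onD[OF bij_betw_imp_inj_on[OF t(1)], of W ?W] that W by metis
  then have "u W * (if Z = tau n X ` W then 1 else 0) = (if W = ?W then u W else 0)"
    if "W \<in> Bq (n - 1)" for W
    by (simp only: that if_distrib[where f = "\<lambda>x. _ * x"] mult_1_right mult_zero_right)
  then have "mu n X u Z = (\<Sum>W\<in>Bq (n - 1). if W = ?W then u W else 0)"
    unfolding mu_def lin_ext_apply basis_vec_def by (intro sum.cong refl)
  also have "\<dots> = u ?W" using W(1) by (simp only: sum.delta finite_Bq if_True)
  finally show ?thesis .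
qed

text \<open>A lift occurs in the image of exactly one basis vector, that of its section.\<close>

lemma theta_apply:
  fixes u :: "'a::{field,finite} cvec"
  shows "theta n u Y = (if Y \<in> Aq (Suc n) then u (Y \<inter> Fq n) else 0)"
proof -
  have "theta n u Y = (\<Sum>Z\<in>Bq n. if Z = Y \<inter> Fq n then if Y \<in> Aq (Suc n) then u Z else 0 else 0)"
    unfolding theta_def lin_ext_apply sum_fun_apply basis_vec_def
    by (intro sum.cong) (auto simp: sum.delta')
  then show ?thesis using Aq_section[of Y n] by (simp add: sum.delta)
qed

lemma lambda_apply:
  fixes \<chi> :: "'a::{field,finite} mat \<Rightarrow> complex"
  shows "lambda n \<chi> u Y = (\<Sum>Z\<in>subspaces_of (Xchi n \<chi>).
    u Z * (1 / of_nat (CARD('a) ^ fv.dim Z) * pchi n \<chi> (basis_vec (hat n Z)) Y))"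
  by (simp only: lambda_def lin_ext_apply fscale_apply)

lemma lambda_apply_eq_0:
  fixes \<chi> :: "'a::{field,finite} mat \<Rightarrow> complex"
  assumes X: "Xchi n \<chi> \<subseteq> Fq n" and Y: "\<not> (Y \<in> Aq (Suc n) \<and> Y \<inter> Fq n \<subseteq> Xchi n \<chi>)"
  shows "lambda n \<chi> u Y = 0"
  unfolding lambda_apply
proof (intro sum.neutral ballI)
  fix Z assume "Z \<in> subspaces_of (Xchi n \<chi>)"
  then have "Z \<in> Bq n" "Z \<subseteq> Xchi n \<chi>" using X by (auto simp: subspaces_of_def)
  then show "u Z * (1 / of_nat (CARD('a) ^ fv.dim Z) * pchi n \<chi> (basis_vec (hat n Z)) Y) = 0"
    using pchi_hat_eq_0[of Z n Y \<chi>] Y by auto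
qed

text \<open>Only the section of \<open>Y\<close> contributes. The normalising power of
  \<open>q\<close> in \<open>lambda\<close> cancels the size of the character sum, leaving a
  conjugated character value, which has modulus 1.\<close>

lemma cmod_lambda_apply:
  fixes \<chi> :: "'a::{field,finite} mat \<Rightarrow> complex"
  assumes \<chi>: "\<chi> \<in> Nq n" and Y: "Y \<in> Aq (Suc n)" "Y \<inter> Fq n \<subseteq> Xchi n \<chi>"
  shows "cmod (lambda n \<chi> u Y) = cmod (u (Y \<inter> Fq n))"
proof -
  let ?Z = "Y \<inter> Fq n"
  obtain b where b: "b \<in> Fq n" "b \<noteq> 0" "Xchi n \<chi> = perp n b" "\<forall>x\<in>perp n b. \<chi> (hmat n x) = 1"
    using Xchi_eq_perp[OF \<chi>] .
  obtain w where w: "w \<in> Fq n" "unit_fun n + w \<in> Y" using Aq_obtain_lift[OF Y(1)] .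
  have XF: "Xchi n \<chi> \<subseteq> Fq n" using b by (auto simp: perp_def)
  have Z: "?Z \<in> subspaces_of (Xchi n \<chi>)"
    using Aq_section[OF Y(1)] Y(2) by (auto simp: subspaces_of_def)
  have pchi: "pchi n \<chi> (basis_vec (hat n ?Z)) Y =
      cnj (\<chi> (hmat n w)) * of_nat (CARD('a) ^ fv.dim ?Z)"
    using pchi_hat[OF \<chi> Y(1) w] b(3,4) Y(2) by auto
  have fin: "finite (subspaces_of (Xchi n \<chi>))"
    using XF finite_Fq finite_subset finite_subspaces_of by metis
  have other: "pchi n \<chi> (basis_vec (hat n Z)) Y = 0"
    if "Z \<in> subspaces_of (Xchi n \<chi>) - {?Z}" for Z
    using that XF by (intro pchi_hat_eq_0) (auto simp: subspaces_of_def)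
  have "lambda n \<chi> u Y =
      u ?Z * (1 / of_nat (CARD('a) ^ fv.dim ?Z) * pchi n \<chi> (basis_vec (hat n ?Z)) Y)"
    unfolding lambda_apply sum.remove[OF fin Z]
    using other by simp
  also have "\<dots> = u ?Z * cnj (\<chi> (hmat n w))" by (simp add: pchi)
  also have "cmod \<dots> = cmod (u ?Z)"
    using norm_additive_character[OF fv_subspace_Fq _ Nq_additive_character(1)[OF \<chi>] w(1)]
    by (simp add: norm_mult)
  finally show ?thesis .
qed

text \<open>The recursion of \<open>vvec\<close> matches on \<open>Suc (Suc n)\<close>; this and the
  next two lemmas restate it for any index \<open>n\<close> that is at least 1.\<close>

lemma vvec_EZero:
  assumes "n \<ge> 1"
  shows "vvec (Suc n) (\<beta> @ [EZero]) =
    fscale (of_nat CARD('a) ^ nonzeros \<beta>) (vvec n \<beta>) + theta n (vvec n (\<beta> :: 'a::{field,finite} entry list))"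
  using assms by (cases n) simp_all

lemma vvec_EOne:
  assumes "n \<ge> 1"
  shows "vvec (Suc n) (\<beta> @ [EOne]) =
    fscale (of_nat CARD('a) ^ (n - nonzeros \<beta>)) (vvec n \<beta>) - theta n (vvec n (\<beta> :: 'a::{field,finite} entry list))"
  using assms by (cases n) simp_all

lemma vvec_EChar:
  assumes "n \<ge> 1"
  shows "vvec (Suc n) (\<beta> @ [EChar \<chi>]) = lambda n \<chi> (mu n (Xchi n \<chi>) (vvec (n - 1) \<beta>))"
  using assms by (cases n) simp_all

lemma Xchi_tau:
  fixes \<chi> :: "'a::{field,finite} mat \<Rightarrow> complex"
  assumes "\<chi> \<in> Nq n"
  shows "Xchi n \<chi> \<subseteq> Fq n" "bij_betw (tau n (Xchi n \<chi>)) (Fq (n - 1)) (Xchi n \<chi>)"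
proof -
  obtain b where b: "b \<in> Fq n" "b \<noteq> 0" "Xchi n \<chi> = perp n b"
    using Xchi_eq_perp[OF assms] .
  then show "Xchi n \<chi> \<subseteq> Fq n" "bij_betw (tau n (Xchi n \<chi>)) (Fq (n - 1)) (Xchi n \<chi>)"
    using bij_betw_tau by (auto simp: perp_def)
qed

lemma cmod_vvec_EChar:
  fixes \<chi> :: "'a::{field,finite} mat \<Rightarrow> complex"
  assumes n: "n \<ge> 1" and \<chi>: "\<chi> \<in> Nq n"
  shows "cmod (vvec (Suc n) (\<beta> @ [EChar \<chi>]) Y) =
    (if Y \<in> Aq (Suc n) \<and> Y \<inter> Fq n \<subseteq> Xchi n \<chi>
     then cmod (vvec (n - 1) \<beta> (inv_into (Fq (n - 1)) (tau n (Xchi n \<chi>)) ` (Y \<inter> Fq n))) else 0)"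
proof (cases "Y \<in> Aq (Suc n) \<and> Y \<inter> Fq n \<subseteq> Xchi n \<chi>")
  case True
  then have "Y \<inter> Fq n \<in> subspaces_of (Xchi n \<chi>)"
    using Aq_section[of Y n] by (auto simp: subspaces_of_def)
  then show ?thesis
    using True by (simp add: vvec_EChar[OF n] cmod_lambda_apply[OF \<chi>] mu_apply[OF Xchi_tau(2)[OF \<chi>]])
next
  case False
  then show ?thesis
    by (auto simp: vvec_EChar[OF n] lambda_apply_eq_0[OF Xchi_tau(1)[OF \<chi>]])
qed

text \<open>Separates the two summands of the recursion: \<open>vvec n \<beta>\<close> vanishes on
  \<open>Aq (Suc n)\<close>, and the \<open>theta\<close> term vanishes off it. The induction goes
  back two steps, as \<open>Eq\<close> does.\<close>

lemma vvec_support: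
  fixes \<alpha> :: "'a::{field,finite} entry list"
  shows "\<alpha> \<in> Eq n \<Longrightarrow> Y \<notin> Bq n \<Longrightarrow> vvec n \<alpha> Y = 0"
proof (induction n arbitrary: \<alpha> rule: induct_nat_012)
  case 0
  have "{0 :: nat \<Rightarrow> 'a} \<in> Bq 0"
    by (auto simp: subspaces_of_def fv.subspace_def fscale_def Fq_def)
  then show ?case using 0 by (auto simp: basis_vec_def)
next
  case 1
  have "{0 :: nat \<Rightarrow> 'a} \<in> Bq 1" "(Fq 1 :: (nat \<Rightarrow> 'a) set) \<in> Bq 1"
    by (auto simp: subspaces_of_def fv_subspace_Fq fv.subspace_def fscale_def Fq_def)
  then show ?case using 1 by (auto simp: basis_vec_def)
next
  case (ge2 n)
  have Y: "Y \<notin> Bq (Suc n)" "Y \<notin> Aq (Suc (Suc n))"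
    using ge2.prems(2) unfolding Bq_Suc(1)[of "Suc n"] by blast+
  from ge2.prems(1) consider \<beta> a where "\<alpha> = \<beta> @ [a]" "\<beta> \<in> Eq (Suc n)" "a \<in> {EZero, EOne}"
    | \<beta> \<chi> where "\<alpha> = \<beta> @ [EChar \<chi>]" "\<beta> \<in> Eq n" "\<chi> \<in> Nq (Suc n)"
    by auto
  then show ?case
  proof cases
    case 1
    then show ?thesis
      using ge2.IH(2)[OF 1(2) Y(1)] Y(2)
      by (auto simp: vvec_EZero vvec_EOne theta_apply fscale_def simp del: vvec.simps)
  next
    case 2
    show ?thesis using cmod_vvec_EChar[OF _ 2(3), of \<beta> Y] Y(2) 2(1) by (simp del: vvec.simps)
  qed
qed

lemma vvec_EZero_apply:
  fixes \<beta> :: "'a::{field,finite} entry list"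
  assumes n: "n \<ge> 1" and \<beta>: "\<beta> \<in> Eq n"
  shows "vvec (Suc n) (\<beta> @ [EZero]) Y =
    (if Y \<in> Aq (Suc n) then vvec n \<beta> (Y \<inter> Fq n) else of_nat CARD('a) ^ nonzeros \<beta> * vvec n \<beta> Y)"
  using vvec_support[OF \<beta>, of Y] Bq_Suc(2)[of n]
  by (auto simp: vvec_EZero[OF n] theta_apply fscale_def)

lemma vvec_EOne_apply:
  fixes \<beta> :: "'a::{field,finite} entry list"
  assumes n: "n \<ge> 1" and \<beta>: "\<beta> \<in> Eq n"
  shows "vvec (Suc n) (\<beta> @ [EOne]) Y =
    (if Y \<in> Aq (Suc n) then - vvec n \<beta> (Y \<inter> Fq n)
     else of_nat CARD('a) ^ (n - nonzeros \<beta>) * vvec n \<beta> Y)"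
  using vvec_support[OF \<beta>, of Y] Bq_Suc(2)[of n]
  by (auto simp: vvec_EOne[OF n] theta_apply fscale_def)

section \<open>Norms\<close>

text \<open>The norm depends on the moduli of the coordinates only, and moduli are what
  \<open>cmod_vvec_EChar\<close> and \<open>cmod_vvec_bar\<close> provide.\<close>

lemma cinner_self:
  fixes v :: "'a::{field,finite} cvec"
  shows "cinner m v v = (\<Sum>X\<in>Bq m. complex_of_real ((cmod (v X))\<^sup>2) *
    of_nat (CARD('a) ^ (fv.dim X choose 2))) / of_nat (Pq CARD('a) m)"
proof -
  have "cnj z * z = complex_of_real ((cmod z)\<^sup>2)" for z
    by (simp add: complex_norm_square mult.commute flip: of_real_power)
  then show ?thesis by (simp add: cinner_def sum_divide_distrib)
qed

lemma cinner_self_cong: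
  fixes u v :: "'a::{field,finite} cvec"
  assumes "\<And>Y. Y \<in> Bq m \<Longrightarrow> cmod (u Y) = cmod (v Y)"
  shows "cinner m u u = cinner m v v"
  unfolding cinner_self using assms by simp

lemma sum_Bq_Suc:
  "(\<Sum>Y\<in>Bq (Suc n). f Y) = (\<Sum>Y\<in>Bq n. f Y) + (\<Sum>Y\<in>Aq (Suc n). f Y)"
  for f :: "(nat \<Rightarrow> 'a::{field,finite}) set \<Rightarrow> complex"
  unfolding Bq_Suc(1) using Bq_Suc(2) by (intro sum.union_disjoint) auto

lemma of_nat_Pq_Suc:
  "complex_of_nat (Pq q (Suc m)) = of_nat (Pq q m) * (1 + of_nat q ^ m)"
  by (simp add: Pq_def algebra_simps)

text \<open>Serves both \<open>EZero\<close> and \<open>EOne\<close>, since a sign does not affect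
  moduli. Subspaces of \<open>Fq n\<close> contribute the factor \<open>q^(2k)\<close>, lifts
  contribute \<open>q^n\<close> by \<open>sum_Aq\<close>, and \<open>Pq\<close> gains the factor
  \<open>1 + q^n\<close>.\<close>

lemma cinner_self_extension:
  fixes u v :: "'a::{field,finite} cvec"
  assumes B: "\<And>Y. Y \<in> Bq n \<Longrightarrow> cmod (v Y) = real CARD('a) ^ k * cmod (u Y)"
    and A: "\<And>Y. Y \<in> Aq (Suc n) \<Longrightarrow> cmod (v Y) = cmod (u (Y \<inter> Fq n))"
  shows "cinner (Suc n) v v =
    (of_nat CARD('a) ^ n + of_nat CARD('a) ^ (2 * k)) / (1 + of_nat CARD('a) ^ n) * cinner n u u"
proof -
  let ?q = "of_nat CARD('a) :: complex"
  let ?F = "\<lambda>Y. complex_of_real ((cmod (u Y))\<^sup>2)"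
  let ?e = "\<lambda>Y. of_nat (CARD('a) ^ (fv.dim Y choose 2)) :: complex"
  let ?S = "\<Sum>Y\<in>Bq n. ?F Y * ?e Y"
  have "(\<Sum>Y\<in>Bq n. complex_of_real ((cmod (v Y))\<^sup>2) * ?e Y) = ?q ^ (2 * k) * ?S"
    unfolding sum_distrib_left
    by (intro sum.cong) (auto simp: B power_mult_distrib power_mult mult_ac simp flip: power_mult)
  moreover have "(\<Sum>Y\<in>Aq (Suc n). complex_of_real ((cmod (v Y))\<^sup>2) * ?e Y) =
      (\<Sum>Y\<in>Aq (Suc n). ?F (Y \<inter> Fq n) * ?e Y)"
    by (intro sum.cong) (auto simp: A)
  then have "(\<Sum>Y\<in>Aq (Suc n). complex_of_real ((cmod (v Y))\<^sup>2) * ?e Y) = ?q ^ n * ?S"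
    by (rule trans) (rule sum_Aq)
  ultimately have "cinner (Suc n) v v =
      (?q ^ (2 * k) * ?S + ?q ^ n * ?S) / of_nat (Pq CARD('a) (Suc n))"
    unfolding cinner_self sum_Bq_Suc by simp
  also have "?q ^ (2 * k) * ?S + ?q ^ n * ?S = (?q ^ n + ?q ^ (2 * k)) * ?S"
    by (simp add: distrib_right)
  finally have v: "cinner (Suc n) v v =
      (?q ^ n + ?q ^ (2 * k)) * ?S / (of_nat (Pq CARD('a) n) * (1 + ?q ^ n))"
    unfolding of_nat_Pq_Suc .
  have u: "cinner n u u = ?S / of_nat (Pq CARD('a) n)" by (rule cinner_self)
  show ?thesis unfolding u v by (simp only: times_divide_times_eq mult.commute)
qed

text \<open>The lifts contribute \<open>q^(m+1)\<close> times a sum over subspaces of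
  \<open>X\<close>, which \<open>tau\<close> identifies with \<open>Bq m\<close>, preserving
  dimensions and hence weights. \<open>Pq\<close> gains two factors because the index rises by
  two.\<close>

lemma cinner_self_EChar:
  fixes u v :: "'a::{field,finite} cvec"
  assumes XF: "X \<subseteq> Fq (Suc m)" and bij: "bij_betw (tau n X) (Fq m) X"
    and v: "\<And>Y. cmod (v Y) = (if Y \<in> Aq (Suc (Suc m)) \<and> Y \<inter> Fq (Suc m) \<subseteq> X
      then cmod (u (inv_into (Fq m) (tau n X) ` (Y \<inter> Fq (Suc m)))) else 0)"
  shows "cinner (Suc (Suc m)) v v = of_nat CARD('a) ^ Suc m /
    ((1 + of_nat CARD('a) ^ m) * (1 + of_nat CARD('a) ^ Suc m)) * cinner m u u"
proof -
  let ?q = "of_nat CARD('a) :: complex"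
  \<comment> \<open>Extended by 0 to subspaces not inside \<open>X\<close>, because
    \<open>sum_Aq\<close> ranges over all of \<open>Bq (Suc m)\<close>.\<close>
  let ?F = "\<lambda>Z. if Z \<subseteq> X then complex_of_real ((cmod (u (inv_into (Fq m) (tau n X) ` Z)))\<^sup>2) else 0"
  let ?e = "\<lambda>Y. of_nat (CARD('a) ^ (fv.dim Y choose 2)) :: complex"
  let ?S = "\<Sum>W\<in>Bq m. complex_of_real ((cmod (u W))\<^sup>2) * ?e W"
  note t = tau_image_bij_betw[OF bij]
  have "(\<Sum>Y\<in>Bq (Suc m). complex_of_real ((cmod (v Y))\<^sup>2) * ?e Y) = 0"
    using Bq_Suc(2)[of "Suc m"] by (intro sum.neutral) (auto simp: v)
  moreover have "(\<Sum>Y\<in>Aq (Suc (Suc m)). complex_of_real ((cmod (v Y))\<^sup>2) * ?e Y) =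
      (\<Sum>Y\<in>Aq (Suc (Suc m)). ?F (Y \<inter> Fq (Suc m)) * ?e Y)"
    by (intro sum.cong) (auto simp: v)
  then have "(\<Sum>Y\<in>Aq (Suc (Suc m)). complex_of_real ((cmod (v Y))\<^sup>2) * ?e Y) =
      ?q ^ Suc m * (\<Sum>Z\<in>Bq (Suc m). ?F Z * ?e Z)"
    by (rule trans) (rule sum_Aq)
  moreover have "(\<Sum>Z\<in>Bq (Suc m). ?F Z * ?e Z) = (\<Sum>Z\<in>subspaces_of X. ?F Z * ?e Z)"
    using XF by (intro sum.mono_neutral_right) (auto simp: subspaces_of_def)
  moreover have "\<dots> = (\<Sum>W\<in>Bq m. ?F (tau n X ` W) * ?e (tau n X ` W))"
    by (rule sum.reindex_bij_betw[OF t(1), symmetric])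
  moreover have "\<dots> = ?S"
  proof (intro sum.cong refl)
    fix W :: "(nat \<Rightarrow> 'a) set" assume W: "W \<in> Bq m"
    have "inv_into (Fq m) (tau n X) ` (tau n X ` W) = W"
      using bij BqD(2)[OF W] by (intro inv_into_image_cancel) (auto simp: bij_betw_def)
    moreover have "tau n X ` W \<subseteq> X" using bij BqD(2)[OF W] by (auto simp: bij_betw_def)
    ultimately show "?F (tau n X ` W) * ?e (tau n X ` W) =
        complex_of_real ((cmod (u W))\<^sup>2) * ?e W"
      by (simp add: dim_tau_image[OF bij W])
  qed
  ultimately have "cinner (Suc (Suc m)) v v = ?q ^ Suc m * ?S / of_nat (Pq CARD('a) (Suc (Suc m)))"
    unfolding cinner_self sum_Bq_Suc by simp
  then have v: "cinner (Suc (Suc m)) v v =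
      ?q ^ Suc m * ?S / (of_nat (Pq CARD('a) m) * (1 + ?q ^ m) * (1 + ?q ^ Suc m))"
    unfolding of_nat_Pq_Suc .
  have u: "cinner m u u = ?S / of_nat (Pq CARD('a) m)" by (rule cinner_self)
  show ?thesis unfolding u v by (simp only: times_divide_times_eq mult_ac)
qed

section \<open>Interchanging the entries 0 and 1\<close>

lemma nonzeros_snoc: "nonzeros (\<beta> @ [a]) = nonzeros \<beta> + (if a = EZero then 0 else 1)"
  by (simp add: nonzeros_def)

lemma bar_snoc: "bar (\<beta> @ [a]) = bar \<beta> @ [swap_entry a]"
  by (simp add: bar_def)

text \<open>An entry 0 or 1 counts in exactly one of the two sequences and raises the index by one;
  a character counts in both and raises it by two.\<close>

lemma nonzeros_bar: "\<alpha> \<in> Eq n \<Longrightarrow> nonzeros (bar \<alpha>) + nonzeros \<alpha> = n"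
proof (induction n arbitrary: \<alpha> rule: induct_nat_012)
  case (ge2 n)
  then show ?case by (fastforce simp: nonzeros_snoc bar_snoc)
qed (auto simp: nonzeros_def bar_def)

text \<open>For \<open>\<beta> \<in> Eq m\<close>, the exponent \<open>nonzeros \<beta>\<close> of
  an appended 0 equals the exponent \<open>m - nonzeros (bar \<beta>)\<close> of the 1 that replaces
  it; at lifts the two cases differ by a sign. Induction does the rest.\<close>

lemma cmod_vvec_bar:
  fixes \<alpha> :: "'a::{field,finite} entry list"
  shows "\<alpha> \<in> Eq n \<Longrightarrow> cmod (vvec n (bar \<alpha>) Y) = cmod (vvec n \<alpha> Y)"
proof (induction n arbitrary: \<alpha> Y rule: induct_nat_012)
  case 1
  \<comment> \<open>If the two subspaces coincided, the sum and the difference of their basis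
    vectors would have different moduli.\<close>
  have "Fq 1 \<noteq> {0 :: nat \<Rightarrow> 'a}"
    using card_Fq[of 1, where 'a='a] CARD_field_gt_1[where 'a='a] by auto
  then show ?case using 1 by (auto simp: bar_def basis_vec_def)
next
  case (ge2 n)
  from ge2.prems(1) consider \<beta> a where "\<alpha> = \<beta> @ [a]" "\<beta> \<in> Eq (Suc n)" "a \<in> {EZero, EOne}"
    | \<beta> \<chi> where "\<alpha> = \<beta> @ [EChar \<chi>]" "\<beta> \<in> Eq n" "\<chi> \<in> Nq (Suc n)"
    by auto
  then show ?case
  proof cases
    case 1
    have "nonzeros (bar \<beta>) + nonzeros \<beta> = Suc n" using nonzeros_bar 1(2) by blast
    then have "Suc n - nonzeros \<beta> = nonzeros (bar \<beta>)" "Suc n - nonzeros (bar \<beta>) = nonzeros \<beta>"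
      by auto
    then show ?thesis
      using 1 ge2.IH(2)[OF 1(2)] bar_in_Eq[OF 1(2)]
      by (auto simp: bar_snoc vvec_EZero_apply vvec_EOne_apply norm_mult simp del: vvec.simps)
  next
    case 2
    show ?thesis
      using 2 ge2.IH(1)[OF 2(2)] cmod_vvec_EChar[OF _ 2(3)]
      by (simp add: bar_snoc del: vvec.simps)
  qed
qed (auto simp: bar_def)

theorem theorem4p5:
  fixes n q :: nat
  assumes "n \<ge> 1" and "q = CARD('a::{field,finite})"
  shows
    "(\<forall>\<beta> \<in> (Eq n :: 'a entry list set). \<forall>k. nonzeros \<beta> = k \<longrightarrow>
        (\<forall>\<alpha>. \<alpha> = \<beta> @ [EZero] \<longrightarrow>
          (\<forall>Y \<in> Bq (n + 1).
             (Y \<in> Bq n \<longrightarrow> vvec (n + 1) \<alpha> Y = of_nat q ^ k * vvec n \<beta> Y) \<and>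
             (Y \<in> Aq (n + 1) \<longrightarrow> vvec (n + 1) \<alpha> Y = vvec n \<beta> (Y \<inter> Fq n))) \<and>
          cinner (n + 1) (vvec (n + 1) \<alpha>) (vvec (n + 1) \<alpha>) =
            (of_nat q ^ n + of_nat q ^ (2 * k)) / (1 + of_nat q ^ n) *
            cinner n (vvec n \<beta>) (vvec n \<beta>)) \<and>
        (\<forall>\<alpha>. \<alpha> = \<beta> @ [EOne] \<longrightarrow>
          (\<forall>Y \<in> Bq (n + 1).
             (Y \<in> Bq n \<longrightarrow> vvec (n + 1) \<alpha> Y = of_nat q ^ (n - k) * vvec n \<beta> Y) \<and>
             (Y \<in> Aq (n + 1) \<longrightarrow> vvec (n + 1) \<alpha> Y = - vvec n \<beta> (Y \<inter> Fq n))) \<and>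
          cinner (n + 1) (vvec (n + 1) \<alpha>) (vvec (n + 1) \<alpha>) =
            (of_nat q ^ n + of_nat q ^ (2 * (n - k))) / (1 + of_nat q ^ n) *
            cinner n (vvec n \<beta>) (vvec n \<beta>)))
     \<and>
     (\<forall>\<beta> \<in> (Eq (n - 1) :: 'a entry list set). \<forall>\<chi> \<in> Nq n. \<forall>\<alpha> X.
        \<alpha> = \<beta> @ [EChar \<chi>] \<and> X = Xchi n \<chi> \<longrightarrow>
          (\<forall>Y \<in> Bq (n + 1).
             (Y \<in> Bq n \<longrightarrow> cmod (vvec (n + 1) \<alpha> Y) = 0) \<and>
             (Y \<in> Aq (n + 1) \<and> Y \<inter> Fq n \<subseteq> X \<longrightarrow>
                cmod (vvec (n + 1) \<alpha> Y) =
                cmod (vvec (n - 1) \<beta> (inv_into (Fq (n - 1)) (tau n X) ` (Y \<inter> Fq n)))) \<and>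
             (Y \<in> Aq (n + 1) \<and> \<not> Y \<inter> Fq n \<subseteq> X \<longrightarrow> cmod (vvec (n + 1) \<alpha> Y) = 0)) \<and>
          cinner (n + 1) (vvec (n + 1) \<alpha>) (vvec (n + 1) \<alpha>) =
            of_nat q ^ n / ((1 + of_nat q ^ (n - 1)) * (1 + of_nat q ^ n)) *
            cinner (n - 1) (vvec (n - 1) \<beta>) (vvec (n - 1) \<beta>))
     \<and>
     (\<forall>\<alpha> \<in> (Eq n :: 'a entry list set).
        (\<forall>Y \<in> Bq n. cmod (vvec n \<alpha> Y) = cmod (vvec n (bar \<alpha>) Y)) \<and>
        cinner (n + 1) (vvec n \<alpha>) (vvec n \<alpha>) =
          cinner (n + 1) (vvec n (bar \<alpha>)) (vvec n (bar \<alpha>)))"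
proof (intro conjI ballI allI impI; (elim conjE)?)
  note n = assms(1) and q = assms(2)
  have AB: "Y \<notin> Aq (n + 1)" if "Y \<in> Bq n" for Y :: "(nat \<Rightarrow> 'a) set"
    using that Bq_Suc(2)[of n] by auto
  {
    fix \<beta> \<alpha> :: "'a entry list" and k :: nat
    assume \<beta>: "\<beta> \<in> Eq n" and k: "nonzeros \<beta> = k"
    {
      assume \<alpha>: "\<alpha> = \<beta> @ [EZero]"
      note vals = vvec_EZero_apply[OF n \<beta>, folded q, unfolded k]
      show "vvec (n + 1) \<alpha> Y = of_nat q ^ k * vvec n \<beta> Y" if "Y \<in> Bq n" for Y
        using AB[OF that] by (simp add: \<alpha> vals)
      show "vvec (n + 1) \<alpha> Y = vvec n \<beta> (Y \<inter> Fq n)" if "Y \<in> Aq (n + 1)" for Y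
        using that by (simp add: \<alpha> vals)
      show "cinner (n + 1) (vvec (n + 1) \<alpha>) (vvec (n + 1) \<alpha>) =
          (of_nat q ^ n + of_nat q ^ (2 * k)) / (1 + of_nat q ^ n) *
          cinner n (vvec n \<beta>) (vvec n \<beta>)"
        using cinner_self_extension[of n "vvec (n + 1) \<alpha>" k "vvec n \<beta>"] AB
        by (simp add: \<alpha> vals norm_mult norm_power flip: q)
    next
      assume \<alpha>: "\<alpha> = \<beta> @ [EOne]"
      note vals = vvec_EOne_apply[OF n \<beta>, folded q, unfolded k]
      show "vvec (n + 1) \<alpha> Y = of_nat q ^ (n - k) * vvec n \<beta> Y" if "Y \<in> Bq n" for Y
        using AB[OF that] by (simp add: \<alpha> vals)
      show "vvec (n + 1) \<alpha> Y = - vvec n \<beta> (Y \<inter> Fq n)" if "Y \<in> Aq (n + 1)" for Y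
        using that by (simp add: \<alpha> vals)
      \<comment> \<open>The same extension lemma applies, with exponent \<open>n - k\<close> in
        place of \<open>k\<close>.\<close>
      show "cinner (n + 1) (vvec (n + 1) \<alpha>) (vvec (n + 1) \<alpha>) =
          (of_nat q ^ n + of_nat q ^ (2 * (n - k))) / (1 + of_nat q ^ n) *
          cinner n (vvec n \<beta>) (vvec n \<beta>)"
        using cinner_self_extension[of n "vvec (n + 1) \<alpha>" "n - k" "vvec n \<beta>"] AB
        by (simp add: \<alpha> vals norm_mult norm_power flip: q)
    }
  next
    fix \<beta> \<alpha> :: "'a entry list" and \<chi> X
    assume \<beta>: "\<beta> \<in> Eq (n - 1)" and \<chi>: "\<chi> \<in> Nq n" and \<alpha>: "\<alpha> = \<beta> @ [EChar \<chi>]" and X: "X = Xchi n \<chi>"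
    note vals = cmod_vvec_EChar[OF n \<chi>, of \<beta>, folded X \<alpha>]
    show "cmod (vvec (n + 1) \<alpha> Y) = 0" if "Y \<in> Bq n" for Y
      using AB[OF that] by (simp add: vals del: norm_eq_zero)
    show "cmod (vvec (n + 1) \<alpha> Y) =
        cmod (vvec (n - 1) \<beta> (inv_into (Fq (n - 1)) (tau n X) ` (Y \<inter> Fq n)))"
      if "Y \<in> Aq (n + 1)" "Y \<inter> Fq n \<subseteq> X" for Y
      using that by (simp add: vals)
    show "cmod (vvec (n + 1) \<alpha> Y) = 0" if "Y \<in> Aq (n + 1)" "\<not> Y \<inter> Fq n \<subseteq> X" for Y
      using that by (simp add: vals del: norm_eq_zero)
    \<comment> \<open>Replaces the truncated \<open>n - 1\<close> by \<open>m\<close>, the index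
      form of \<open>cinner_self_EChar\<close>.\<close>
    obtain m where m: "n = Suc m" using n not0_implies_Suc by fastforce
    show "cinner (n + 1) (vvec (n + 1) \<alpha>) (vvec (n + 1) \<alpha>) =
        of_nat q ^ n / ((1 + of_nat q ^ (n - 1)) * (1 + of_nat q ^ n)) *
        cinner (n - 1) (vvec (n - 1) \<beta>) (vvec (n - 1) \<beta>)"
      using cinner_self_EChar[OF Xchi_tau[OF \<chi>, folded X, unfolded m diff_Suc_1]
          vals[unfolded m diff_Suc_1]]
      by (simp add: m q del: vvec.simps power_Suc)
  next
    fix \<alpha> :: "'a entry list"
    assume \<alpha>: "\<alpha> \<in> Eq n"
    show "cmod (vvec n \<alpha> Y) = cmod (vvec n (bar \<alpha>) Y)" for Y
      using cmod_vvec_bar[OF \<alpha>] by simp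
    \<comment> \<open>The product at level \<open>n + 1\<close> also runs over subspaces outside
      \<open>Bq n\<close>; the equality of moduli holds at every \<open>Y\<close>.\<close>
    show "cinner (n + 1) (vvec n \<alpha>) (vvec n \<alpha>) = cinner (n + 1) (vvec n (bar \<alpha>)) (vvec n (bar \<alpha>))"
      by (rule cinner_self_cong) (simp add: cmod_vvec_bar[OF \<alpha>])
  }
qed

end
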